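(* Let $T:\mathbb R\to\mathbb R$ be a surjective Markov map satisfying (A1)-(A4) (see context). For $\alpha\in\aleph_{\mathrm{ter}}$ set $$E_\alpha:=\bigcup_{n\in\mathbb N}T^{-n}M_\alpha,\qquad T_\alpha:=T|_{M_\alpha}:M_\alpha\to M_\alpha .$$ (1) Each ergodic component of $T$ contained in $\mathcal I_{\mathcal C\mathcal D}$ is of the form $E_\alpha$ for some $\alpha\in\aleph_{\mathrm{ter}}$. For such $\alpha$ the following properties hold: $M_\alpha\subseteq\mathcal C$; $E_\alpha\setminus M_\alpha\subseteq\mathcal D$; for a.e. $x\in E_\alpha$, $\omega(x)=M_\alpha$; the map $T_\alpha$ is conservative and ergodic; and, denoting by $d_\alpha$ the period of $\mathbb Z_\alpha$, $M_\alpha$ splits into $d_\alpha$ exact components $M_{\alpha,0},\dots,M_{\alpha,d_\alpha-1}$ of $T_\alpha^{d_\alpha}$, which are cyclic: $T_\alpha M_{\alpha,i}=M_{\alpha,i+1}$ for $0\le i\le d_\alpha-2$ and $T_\alpha M_{\alpha,d_\alpha-1}=M_{\alpha,0}$. (2) Conversely, if $\alpha\in\aleph_{\mathrm{ter}}$ and $\#\mathbb Z_\alpha<\infty$, then $E_\alpha$ is an ergodic component of $T$ contained in $\mathcal I_{\mathcal C\mathcal D}$, with all the properties listed in (1). If $\alpha\in\aleph_{\mathrm{ter}}$ and $\#\mathbb Z_\alpha=\infty$, then $E_\alpha$ is either an ergodic component of $T$ contained in $\mathcal I_{\mathcal C\mathcal D}$, with all the properties listed in (1), or a $T$-invariant subset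 of $\mathcal I_{\mathcal D}$.
   Context: Conventions: $m$ is Lebesgue measure on $\mathbb R$; $\mathbb N=\{0,1,2,\dots\}$, $\mathbb Z^+=\{1,2,\dots\}$; all equalities and inclusions of Borel sets are modulo $m$-null sets. Setting: $(a_j)_{j\in\mathbb Z}$ are reals with $\lim_{j\to\pm\infty}a_j=\pm\infty$, and $I_j:=[a_j,a_{j+1}]$ are the Markov intervals (regarded as a partition of $\mathbb R$, endpoints being ignored). $T:\mathbb R\to\mathbb R$ is a surjective Markov map (values at the points $a_j$ are irrelevant; surjectivity means that each $I_k$ is contained in $TI_j$ for some $j$), with: (A1) there is $\theta>0$ with $0<a_{j+1}-a_j\le\theta$ for all $j$; (A2) $T|_{(a_j,a_{j+1})}$ has a unique extension $\tau_j:I_j\to J_j$ which is twice differentiable and bijective onto $J_j=\bigsqcup_{k=k_{1j}}^{k_{2j}}I_k$, for some integers $k_{1j}\le k_{2j}$; (A3) there is $\lambda>1$ with $|\tau_j'|\ge\lambda$ for all $j$; (A4) there is $\eta>0$ with $|\tau_j''/(\tau_j')^2|\le\eta$ for all $j$. Combinatorics: $I_j$ feeds $I_k$ ($I_k$ is accessible from $I_j$) if $T^nI_j\supseteq I_k$ for some $n\in\mathbb Z^+$. $I_j,I_k$ communicate if $j=k$ or each is accessible from the other; this is an equivalence relation on $\mathbb Z$ whose classes are denoted $\mathbb Z_\alpha$, $\alpha\in\aleph$. Put $M_\alpha:=\bigsqcup_{j\in\mathbb Z_\alpha}I_j$. $I_j$ is inessential if it feeds some $I_k$ which does not feed $I_j$,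 otherwise essential; these are class properties. An essential class fed by at least one state outside it is terminal; $\aleph_{\mathrm{ter}}$ is the set of indices of terminal classes. The period of $I_j$ is the g.c.d. of $\{n\in\mathbb Z^+: T^nI_j\supseteq I_j\}$ ($0$ if empty); it is constant on a communicating class, and is called the period of the class. Conservative/dissipative parts: a Borel set $W$ is wandering if the sets $T^{-n}W$, $n\in\mathbb N$, are pairwise disjoint (mod $m$); $\mathcal D$ is the measurable union of all wandering sets and $\mathcal C:=\mathbb R\setminus\mathcal D$ (a map is conservative if it has no wandering set of positive measure). A set $A$ is $T$-invariant if $T^{-1}A=A$. The invariant hull of $A$ is $\mathcal I(A):=\bigcup_{k\in\mathbb Z^+}\bigcup_{n\in\mathbb N}T^{-k}T^nA$, the smallest $T$-invariant set containing $A$. Put $\mathcal I_{\mathcal C\mathcal D}:=\mathcal I(\mathcal C)\cap\mathcal I(\mathcal D)$ and $\mathcal I_{\mathcal D}:=\mathcal I(\mathcal D)\setminus\mathcal I_{\mathcal C\mathcal D}$. $\omega(x)$ is the set of accumulation points in $\mathbb R$ of the sequence $(T^n(x))_{n\in\mathbb N}$. For a map $S$, an ergodic component of $S$ is an $S$-invariant set $A$ with $m(A)>0$ such that every $S$-invariant subset of $A$ is null or equals $A$ mod $m$. An exact component of $S$ is an ergodic component $A$ such that $S|_A$ is exact, i.e. every set in $\bigcap_{n\ge0}(S|_A)^{-n}\mathscr B_A$ ($\mathscr B_A$ the Borel subsets of $A$) is null or equal to $A$ mod $m$. *)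

theory Defs
  imports "HOL-Analysis.Analysis"
begin

text \<open>
  Relations between subsets of the real line are taken modulo Lebesgue null sets. Writing them
  with the almost-everywhere quantifier keeps them meaningful for forward images, whose
  measurability is not known in advance.
\<close>

definition ae_subset :: "real set \<Rightarrow> real set \<Rightarrow> bool" where
  "ae_subset A B \<longleftrightarrow> (AE x in lborel. x \<in> A \<longrightarrow> x \<in> B)"

definition ae_eq :: "real set \<Rightarrow> real set \<Rightarrow> bool" where
  "ae_eq A B \<longleftrightarrow> (AE x in lborel. x \<in> A \<longleftrightarrow> x \<in> B)"

definition ae_disjoint :: "real set \<Rightarrow> real set \<Rightarrow> bool" where
  "ae_disjoint A B \<longleftrightarrow> (AE x in lborel. \<not> (x \<in> A \<and> x \<in> B))"


subsection \<open>Ergodic notions\<close>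

text \<open>
  A map \<open>S : X \<rightarrow> X\<close>, possibly defined only modulo null sets, is represented by its domain \<open>X\<close>
  and a total function \<open>S\<close>; the preimage of \<open>B\<close> under the \<open>n\<close>-th iterate of \<open>S : X \<rightarrow> X\<close> is
  \<open>(S ^^ n) -` B \<inter> X\<close>.
\<close>

definition invariant_set :: "real set \<Rightarrow> (real \<Rightarrow> real) \<Rightarrow> real set \<Rightarrow> bool" where
  "invariant_set X S A \<longleftrightarrow>
     A \<in> sets borel \<and> ae_subset A X \<and> ae_eq (S -` A \<inter> X) A"

definition wandering :: "real set \<Rightarrow> (real \<Rightarrow> real) \<Rightarrow> real set \<Rightarrow> bool" where
  "wandering X S W \<longleftrightarrow>
     W \<in> sets borel \<and> ae_subset W X \<and>
     (\<forall>i j. i \<noteq> j \<longrightarrow> ae_disjoint ((S ^^ i) -` W \<inter> X) ((S ^^ j) -` W \<inter> X))"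

definition conservative :: "real set \<Rightarrow> (real \<Rightarrow> real) \<Rightarrow> bool" where
  "conservative X S \<longleftrightarrow> \<not> (\<exists>W. wandering X S W \<and> emeasure lborel W > 0)"

definition ergodic :: "real set \<Rightarrow> (real \<Rightarrow> real) \<Rightarrow> bool" where
  "ergodic X S \<longleftrightarrow> (\<forall>A. invariant_set X S A \<longrightarrow> emeasure lborel A = 0 \<or> ae_eq A X)"

definition ergodic_component :: "real set \<Rightarrow> (real \<Rightarrow> real) \<Rightarrow> real set \<Rightarrow> bool" where
  "ergodic_component X S A \<longleftrightarrow>
     invariant_set X S A \<and> emeasure lborel A > 0 \<and>
     (\<forall>B. invariant_set X S B \<and> ae_subset B A \<longrightarrow> emeasure lborel B = 0 \<or> ae_eq B A)"

definition exact :: "real set \<Rightarrow> (real \<Rightarrow> real) \<Rightarrow> bool" where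
  "exact A S \<longleftrightarrow>
     (\<forall>B. B \<in> sets borel \<and> ae_subset B A \<and>
          (\<forall>n. \<exists>C. C \<in> sets borel \<and> C \<subseteq> A \<and> ae_eq B ((S ^^ n) -` C \<inter> A))
        \<longrightarrow> emeasure lborel B = 0 \<or> ae_eq B A)"

definition exact_component :: "real set \<Rightarrow> (real \<Rightarrow> real) \<Rightarrow> real set \<Rightarrow> bool" where
  "exact_component X S A \<longleftrightarrow> ergodic_component X S A \<and> exact A S"


subsection \<open>Conservative and dissipative parts\<close>

text \<open>
  A measurable union of a family of Borel sets is its least upper bound modulo null sets; the
  set-theoretic union of an uncountable family would be the wrong object.
\<close>

definition is_measurable_union :: "real set set \<Rightarrow> real set \<Rightarrow> bool" where
  "is_measurable_union F D \<longleftrightarrow>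
     D \<in> sets borel \<and> (\<forall>W\<in>F. ae_subset W D) \<and>
     (\<forall>B\<in>sets borel. (\<forall>W\<in>F. ae_subset W B) \<longrightarrow> ae_subset D B)"

lemma measurable_union_exists:
  assumes F: "F \<subseteq> sets borel"
  shows "\<exists>D. is_measurable_union F D"
proof -
  obtain h :: "real \<Rightarrow> ennreal" where h: "h \<in> borel_measurable lborel"
    "integral\<^sup>N lborel h \<noteq> \<infinity>" and pos: "\<And>x. 0 < h x"
    using sigma_finite_measure.Ex_finite_integrable_function[OF sigma_finite_lborel] by auto
  define N where "N = density lborel h"
  have [simp]: "sets N = sets borel" by (simp add: N_def)
  have fin: "emeasure N A \<noteq> \<infinity>" for A
  proof -
    have "emeasure N A \<le> emeasure N (space N)" by (rule emeasure_space)
    also have "\<dots> = integral\<^sup>N lborel h"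
      using h by (simp add: N_def emeasure_density)
    finally show ?thesis using h(2) by (auto simp: top_unique)
  qed
  define G where "G = {\<Union>U | U. countable U \<and> U \<subseteq> F}"
  have "{} \<in> G" unfolding G_def by force
  then have "G \<noteq> {}" by auto
  from ennreal_SUP_countable_SUP[OF this, of "emeasure N"]
  obtain g :: "nat \<Rightarrow> ennreal" where g: "range g \<subseteq> emeasure N ` G"
    "Sup (emeasure N ` G) = Sup (range g)" by auto
  from g(1) have "\<forall>i. \<exists>U. g i = emeasure N (\<Union>U) \<and> countable U \<and> U \<subseteq> F"
    unfolding G_def by (fastforce simp: image_subset_iff)
  then obtain U where U: "\<And>i. g i = emeasure N (\<Union>(U i))" "\<And>i. countable (U i)" "\<And>i. U i \<subseteq> F"
    by metis
  define V where "V = (\<Union>i. U i)"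
  have V: "countable V" "V \<subseteq> F" using U by (auto simp: V_def)
  have bor: "\<Union>Y \<in> sets borel" if "countable Y" "Y \<subseteq> F" for Y
    using that F by (intro sets.countable_Union) auto
  have "ae_subset W (\<Union>V)" if W: "W \<in> F" for W
  proof -
    have Wb: "W \<in> sets borel" using W F by auto
    have "g i \<le> emeasure N (\<Union>V)" for i
      unfolding U(1) by (rule emeasure_mono) (use bor[OF V] in \<open>auto simp: V_def\<close>)
    then have *: "Sup (emeasure N ` G) \<le> emeasure N (\<Union>V)" unfolding g(2) by (auto intro: SUP_least)
    have "\<Union>(insert W V) \<in> G" unfolding G_def using V W by blast
    then have "emeasure N (\<Union>(insert W V)) \<le> Sup (emeasure N ` G)" by (rule SUP_upper)
    with * have "emeasure N (W \<union> \<Union>V) \<le> emeasure N (\<Union>V)" by simp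
    moreover have "emeasure N (W \<union> \<Union>V) = emeasure N (\<Union>V) + emeasure N (W - \<Union>V)"
      by (subst plus_emeasure) (use bor[OF V] Wb in \<open>auto intro: arg_cong[where f="emeasure N"]\<close>)
    ultimately have "emeasure N (\<Union>V) + emeasure N (W - \<Union>V) \<le> emeasure N (\<Union>V) + 0" by simp
    then have "emeasure N (W - \<Union>V) = 0"
      using fin[of "\<Union>V"] by (metis ennreal_add_left_cancel_le infinity_ennreal_def le_zero_eq)
    then have "W - \<Union>V \<in> null_sets (density lborel h)"
      using Wb bor[OF V] by (auto simp: null_sets_def N_def)
    then have "AE x in lborel. x \<in> W - \<Union>V \<longrightarrow> h x = 0"
      using null_sets_density_iff[OF h(1)] by auto
    then show ?thesis unfolding ae_subset_def
      using pos by (auto elim!: eventually_mono simp: order.strict_iff_not)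
  qed
  moreover have "ae_subset (\<Union>V) B" if "\<forall>W\<in>F. ae_subset W B" for B
  proof -
    have "AE x in lborel. \<forall>W\<in>V. x \<in> W \<longrightarrow> x \<in> B"
      using that V by (subst AE_ball_countable) (auto simp: ae_subset_def)
    then show ?thesis unfolding ae_subset_def by (auto elim!: eventually_mono)
  qed
  ultimately show ?thesis unfolding is_measurable_union_def using bor[OF V] by blast
qed

text \<open>
  Unique modulo null sets by definition; existence is the preceding lemma.
\<close>

definition dissipative_part :: "(real \<Rightarrow> real) \<Rightarrow> real set" where
  "dissipative_part T = (SOME D. is_measurable_union {W. wandering UNIV T W} D)"

definition conservative_part :: "(real \<Rightarrow> real) \<Rightarrow> real set" where
  "conservative_part T = UNIV - dissipative_part T"

definition invariant_hull :: "(real \<Rightarrow> real) \<Rightarrow> real set \<Rightarrow> real set" where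
  "invariant_hull T A = (\<Union>k\<in>{1..}. \<Union>n. (T ^^ k) -` ((T ^^ n) ` A))"

definition hull_CD :: "(real \<Rightarrow> real) \<Rightarrow> real set" where
  "hull_CD T = invariant_hull T (conservative_part T) \<inter> invariant_hull T (dissipative_part T)"

definition hull_D :: "(real \<Rightarrow> real) \<Rightarrow> real set" where
  "hull_D T = invariant_hull T (dissipative_part T) - hull_CD T"

definition omega_limit :: "(real \<Rightarrow> real) \<Rightarrow> real \<Rightarrow> real set" where
  "omega_limit T x = {y. \<forall>e>0. \<exists>\<^sub>F n in sequentially. dist ((T ^^ n) x) y < e}"


subsection \<open>Markov maps\<close>

definition markov_interval :: "(int \<Rightarrow> real) \<Rightarrow> int \<Rightarrow> real set" where
  "markov_interval a j = {a j..a (j + 1)}"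

text \<open>
  The functions \<open>\<tau> j\<close> are the branches of \<open>T\<close>, with first and second derivatives \<open>\<tau>' j\<close> and
  \<open>\<tau>'' j\<close>, one-sided at the endpoints. The branch \<open>\<tau> j\<close> is determined by \<open>T\<close> on the \<open>j\<close>-th
  interval by continuity, and its values elsewhere are immaterial. Nothing is assumed about
  the values of \<open>T\<close> at the points \<open>a j\<close>.
\<close>

locale expanding_markov_map =
  fixes a :: "int \<Rightarrow> real" and T :: "real \<Rightarrow> real"
    and \<tau> \<tau>' \<tau>'' :: "int \<Rightarrow> real \<Rightarrow> real"
  assumes a_at_top: "filterlim a at_top at_top"
    and a_at_bot: "filterlim a at_bot at_bot"
    and surjective: "\<forall>k. \<exists>j. ae_subset (markov_interval a k) (T ` markov_interval a j)"
    and A1: "\<exists>\<theta>>0. \<forall>j. 0 < a (j + 1) - a j \<and> a (j + 1) - a j \<le> \<theta>"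
    and A2_extends: "\<forall>j. \<forall>x\<in>{a j<..<a (j + 1)}. \<tau> j x = T x"
    and A2_deriv: "\<forall>j. \<forall>x\<in>markov_interval a j.
          (\<tau> j has_real_derivative \<tau>' j x) (at x within markov_interval a j)"
    and A2_deriv2: "\<forall>j. \<forall>x\<in>markov_interval a j.
          (\<tau>' j has_real_derivative \<tau>'' j x) (at x within markov_interval a j)"
    and A2_bij: "\<forall>j. \<exists>k1 k2. k1 \<le> k2 \<and>
          bij_betw (\<tau> j) (markov_interval a j) (\<Union>k\<in>{k1..k2}. markov_interval a k)"
    and A3: "\<exists>\<kappa>>1. \<forall>j. \<forall>x\<in>markov_interval a j. \<bar>\<tau>' j x\<bar> \<ge> \<kappa>"
    and A4: "\<exists>\<eta>>0. \<forall>j. \<forall>x\<in>markov_interval a j. \<bar>\<tau>'' j x / (\<tau>' j x)\<^sup>2\<bar> \<le> \<eta>"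

definition feeds :: "(int \<Rightarrow> real) \<Rightarrow> (real \<Rightarrow> real) \<Rightarrow> int \<Rightarrow> int \<Rightarrow> bool" where
  "feeds a T j k \<longleftrightarrow>
     (\<exists>n\<ge>1. ae_subset (markov_interval a k) ((T ^^ n) ` markov_interval a j))"

definition communicate :: "(int \<Rightarrow> real) \<Rightarrow> (real \<Rightarrow> real) \<Rightarrow> int \<Rightarrow> int \<Rightarrow> bool" where
  "communicate a T j k \<longleftrightarrow> j = k \<or> (feeds a T j k \<and> feeds a T k j)"

text \<open>A communicating class serves as its own index.\<close>

definition comm_classes :: "(int \<Rightarrow> real) \<Rightarrow> (real \<Rightarrow> real) \<Rightarrow> int set set" where
  "comm_classes a T = UNIV // {(j, k). communicate a T j k}"

definition inessential :: "(int \<Rightarrow> real) \<Rightarrow> (real \<Rightarrow> real) \<Rightarrow> int \<Rightarrow> bool" where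
  "inessential a T j \<longleftrightarrow> (\<exists>k. feeds a T j k \<and> \<not> feeds a T k j)"

definition terminal_classes :: "(int \<Rightarrow> real) \<Rightarrow> (real \<Rightarrow> real) \<Rightarrow> int set set" where
  "terminal_classes a T =
     {Z \<in> comm_classes a T. (\<forall>j\<in>Z. \<not> inessential a T j) \<and> (\<exists>j. j \<notin> Z \<and> (\<exists>k\<in>Z. feeds a T j k))}"

definition state_period :: "(int \<Rightarrow> real) \<Rightarrow> (real \<Rightarrow> real) \<Rightarrow> int \<Rightarrow> nat" where
  "state_period a T j =
     Gcd {n. n \<ge> 1 \<and> ae_subset (markov_interval a j) ((T ^^ n) ` markov_interval a j)}"

definition class_period :: "(int \<Rightarrow> real) \<Rightarrow> (real \<Rightarrow> real) \<Rightarrow> int set \<Rightarrow> nat" where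
  "class_period a T Z = (THE d. \<forall>j\<in>Z. state_period a T j = d)"

definition class_region :: "(int \<Rightarrow> real) \<Rightarrow> int set \<Rightarrow> real set" where
  "class_region a Z = (\<Union>j\<in>Z. markov_interval a j)"

definition class_basin :: "(int \<Rightarrow> real) \<Rightarrow> (real \<Rightarrow> real) \<Rightarrow> int set \<Rightarrow> real set" where
  "class_basin a T Z = (\<Union>n. (T ^^ n) -` class_region a Z)"

definition cyclic_exact_splitting ::
    "real set \<Rightarrow> (real \<Rightarrow> real) \<Rightarrow> nat \<Rightarrow> (nat \<Rightarrow> real set) \<Rightarrow> bool" where
  "cyclic_exact_splitting X S d P \<longleftrightarrow>
     (\<forall>i<d. exact_component X (S ^^ d) (P i)) \<and>
     (\<forall>i<d. \<forall>j<d. i \<noteq> j \<longrightarrow> ae_disjoint (P i) (P j)) \<and>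
     ae_eq (\<Union>i<d. P i) X \<and>
     (\<forall>i<d. ae_eq (S ` P i) (P (Suc i mod d)))"

definition regular_terminal_class :: "(int \<Rightarrow> real) \<Rightarrow> (real \<Rightarrow> real) \<Rightarrow> int set \<Rightarrow> bool" where
  "regular_terminal_class a T Z \<longleftrightarrow>
     (let M = class_region a Z; E = class_basin a T Z in
        ae_subset M (conservative_part T) \<and>
        ae_subset (E - M) (dissipative_part T) \<and>
        (AE x in lborel. x \<in> E \<longrightarrow> omega_limit T x = M) \<and>
        conservative M T \<and> ergodic M T \<and>
        (\<exists>P. cyclic_exact_splitting M T (class_period a T Z) P))"

end

theory Submission
  imports Defs "HOL-Number_Theory.Cong"
begin

text \<open>
  Inverse branches of \<open>T ^^ n\<close> have distortion bounded uniformly in \<open>n\<close>, so if \<open>T ^^ n\<close> maps a cylinder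
  onto a cell \<open>k\<close> (the interior of a Markov interval), it preserves relative measures up to a uniform
  constant. Covering a set \<open>F \<subseteq> cell k\<close> of points that return to \<open>cell k\<close> infinitely often by
  minimal returning cylinders inside a slightly larger open set shows that for some return time \<open>n\<close>
  every Borel set containing \<open>T ^^ n\<close> of almost all of \<open>F\<close> nearly fills \<open>cell k\<close>. Hence each cell is
  either recurrent (almost every point returns infinitely often) and contained in the conservative
  part, or contained in the dissipative part; recurrence propagates along transitions, so it is a
  class property, and it holds for one, hence every, state of a finite closed class. The same density
  statement yields ergodicity of a recurrent class, density of its orbits, and exactness of the cyclic
  pieces.
\<close>

text \<open>There are infinitely many cells, their lengths have no positive lower bound, and no
  finite invariant measure is given. Looking only at returns to one fixed cell \<open>k\<close>
  makes the target of the density statement the same set for all return times; hence recurrence of a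
  single cell is the basic notion. The density statement speaks of Borel sets \<open>B\<close>
  containing the image because forward images are not known to be measurable. It is applied to a
  forward invariant \<open>B\<close> that contains \<open>F\<close>: such a \<open>B\<close>
  contains all images of \<open>F\<close> and so fills \<open>cell k\<close> up to every \<epsilon>.
  This settles ergodicity. Exactness needs more, since a tail set is not given as invariant under
  \<open>T ^^ d\<close>; its invariance is proved beforehand, and there the period enters through
  two return times that are consecutive multiples of \<open>d\<close>. Combinatorial arguments run
  along orbits that avoid all endpoints; the remaining points can be discarded because both
  preimages and images of null sets under \<open>T\<close> are null.\<close>

lemma continuous_inj_image_between_imp_interior:
  fixes f :: "real \<Rightarrow> real"
  assumes cont: "continuous_on {c..d} f" and inj: "inj_on f {c..d}"
    and uv: "u \<in> {c..d}" "v \<in> {c..d}" and x: "x \<in> {c..d}" and fx: "f u < f x" "f x < f v"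
  shows "x \<in> {c<..<d}"
proof -
  \<comment> \<open>A continuous injection is strictly monotone on every triple of points, so
    neither endpoint can carry a value strictly between two other values.\<close>
  have mono: "(f p < f q \<and> f q < f r) \<or> (f r < f q \<and> f q < f p)"
    if "c \<le> p" "p < q" "q < r" "r \<le> d" for p q r
  proof -
    have "continuous_on {p..r} f" "inj_on f {p..r}"
      by (rule continuous_on_subset[OF cont] inj_on_subset[OF inj]; use that in auto)+
    then show ?thesis using continuous_inj_imp_mono[of p q r f] that by auto
  qed
  have "x \<noteq> c"
  proof
    assume "x = c"
    moreover have "u \<noteq> v" "u \<noteq> x" "v \<noteq> x" using fx by auto
    ultimately show False using mono[of c u v] mono[of c v u] uv fx by (cases "u < v") auto
  qed
  moreover have "x \<noteq> d"
  proof
    assume "x = d"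
    moreover have "u \<noteq> v" "u \<noteq> x" "v \<noteq> x" using fx by auto
    ultimately show False using mono[of u v d] mono[of v u d] uv fx by (cases "u < v") auto
  qed
  ultimately show ?thesis using x by auto
qed

text \<open>Change of variables with the integrand 1 writes the measure of the image as the integral
  of \<open>\<bar>f'\<bar>\<close> over \<open>Y\<close>. It is applied to inverse branches, where
  the distortion bound controls the quotient of \<open>u\<close> and \<open>l\<close>.\<close>

lemma measure_image_bounds:
  fixes f f' :: "real \<Rightarrow> real"
  assumes Y: "Y \<in> sets lebesgue" "bounded Y" and im: "f ` Y \<in> sets lebesgue" "bounded (f ` Y)"
    and der: "\<And>y. y \<in> Y \<Longrightarrow> (f has_real_derivative f' y) (at y within Y)"
    and inj: "inj_on f Y" and bnd: "\<And>y. y \<in> Y \<Longrightarrow> l \<le> \<bar>f' y\<bar> \<and> \<bar>f' y\<bar> \<le> u"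
  shows "l * measure lebesgue Y \<le> measure lebesgue (f ` Y)"
    and "measure lebesgue (f ` Y) \<le> u * measure lebesgue Y"
proof -
  have lmY: "Y \<in> lmeasurable" and lmI: "f ` Y \<in> lmeasurable"
    using Y im by (auto intro: bounded_set_imp_lmeasurable)
  have "(\<lambda>x. 1::real) absolutely_integrable_on (f ` Y)" "integral (f ` Y) (\<lambda>x. 1::real) = measure lebesgue (f ` Y)"
    using lmI by (auto simp: lmeasure_integral absolutely_integrable_on_const)
  with has_absolute_integral_change_of_variables_1'[OF Y(1) der inj, of "\<lambda>_. 1" "measure lebesgue (f ` Y)"]
  have *: "(\<lambda>x. \<bar>f' x\<bar>) absolutely_integrable_on Y" "integral Y (\<lambda>x. \<bar>f' x\<bar>) = measure lebesgue (f ` Y)"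
    by auto
  then have ion: "(\<lambda>x. \<bar>f' x\<bar>) integrable_on Y" using set_lebesgue_integral_eq_integral(1) by blast
  have c: "(\<lambda>x. c) integrable_on Y" "integral Y (\<lambda>x. c) = c * measure lebesgue Y" for c :: real
    using lmY integral_mult_right[of Y c "\<lambda>_. 1"] by (auto simp: integrable_on_const lmeasure_integral)
  show "l * measure lebesgue Y \<le> measure lebesgue (f ` Y)"
    using integral_le[OF c(1) ion, of l] bnd by (simp add: * c)
  show "measure lebesgue (f ` Y) \<le> u * measure lebesgue Y"
    using integral_le[OF ion c(1), of u] bnd by (simp add: * c)
qed

text \<open>Passing to the completion makes this valid for arbitrary sets, measurable or not, and
  opens the way to the theorem that differentiable images of negligible sets are negligible.\<close>

lemma AE_lborel_iff_negligible: "(AE x in lborel. P x) \<longleftrightarrow> negligible {x. \<not> P x}"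
proof -
  have "(AE x in lborel. P x) \<longleftrightarrow> (AE x in lebesgue. P x)" by (simp add: AE_completion_iff)
  also have "\<dots> \<longleftrightarrow> negligible {x. \<not> P x}"
    unfolding eventually_ae_filter_negligible by (meson negligible_subset order_refl)
  finally show ?thesis .
qed

lemma countable_imp_negligible: "countable (S :: real set) \<Longrightarrow> negligible S"
  using countable_imp_null_set_lborel[of S]
  by (simp add: negligible_iff_null_sets null_sets_completionI)

lemma emeasure_lborel_eq_0_iff: "A \<in> sets borel \<Longrightarrow> emeasure lborel A = 0 \<longleftrightarrow> (AE x in lborel. x \<notin> A)"
  by (subst AE_iff_null_sets[symmetric, of A lborel]) (auto simp: null_sets_def)

text \<open>The least positive difference \<open>g\<close> of two elements divides every element,
  since a nonzero remainder would itself be a smaller difference. So \<open>g\<close> is the gcd,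
  and the two elements realizing it are consecutive multiples. It will be applied to the set of
  return times of a state.\<close>

lemma Gcd_additive_consecutive:
  fixes R :: "nat set"
  assumes ne: "R \<noteq> {}" and pos: "\<And>x. x \<in> R \<Longrightarrow> 0 < x" and add: "\<And>x y. x \<in> R \<Longrightarrow> y \<in> R \<Longrightarrow> x + y \<in> R"
  shows "\<exists>p. Gcd R * p \<in> R \<and> Gcd R * Suc p \<in> R"
proof -
  have mult: "x * Suc q \<in> R" if "x \<in> R" for x q
    using that by (induction q) (auto intro: add)
  define D where "D g \<longleftrightarrow> 0 < g \<and> (\<exists>x\<in>R. x + g \<in> R)" for g
  obtain x0 where "x0 \<in> R" using ne by blast
  then have "D x0" using pos add by (auto simp: D_def)
  define g where "g = (LEAST g. D g)"
  have g: "D g" unfolding g_def by (rule LeastI[of D, OF \<open>D x0\<close>])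
  then obtain y where y: "y \<in> R" "y + g \<in> R" "0 < g" by (auto simp: D_def)
  have gdvd: "g dvd z" if z: "z \<in> R" for z
  proof (rule ccontr)
    assume "\<not> g dvd z"
    then have r: "0 < z mod g" "z mod g < g" using y(3) by (auto simp: mod_greater_zero_iff_not_dvd)
    define q where "q = z div g"
    have zq: "z = g * q + z mod g" by (simp add: q_def)
    \<comment> \<open>The second element exceeds \<open>(y + g) * Suc q + y\<close> by exactly the
      remainder \<open>z mod g\<close>. The factor \<open>Suc q\<close> keeps the multiples inside
      \<open>R\<close>, which does not contain 0, when \<open>q = 0\<close>.\<close>
    have "(y + g) * Suc q \<in> R" "z + y * Suc q + (y + g) \<in> R" using mult y z by (auto intro: add)
    moreover have "z + y * Suc q + (y + g) = (y + g) * Suc q + y + z mod g"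
      using zq by (simp add: algebra_simps)
    moreover have "(y + g) * Suc q + y \<in> R" using calculation(1) y by (auto intro: add)
    ultimately have "D (z mod g)" unfolding D_def using r by metis
    then show False using not_less_Least[of "z mod g" D] r by (simp add: g_def)
  qed
  have "Gcd R dvd g" using y by (metis Gcd_dvd dvd_add_right_iff)
  moreover have "g dvd Gcd R" using gdvd by (auto intro: Gcd_greatest)
  ultimately have "Gcd R = g" by (simp add: dvd_antisym)
  moreover obtain p where "y = g * p" using gdvd[OF y(1)] by auto
  ultimately show ?thesis using y by (intro exI[of _ p]) (auto simp: algebra_simps)
qed

subsection \<open>Inverse branches and bounded distortion\<close>

text \<open>The bounds in (A1), (A3) and (A4) are only asserted to exist; naming them here lets the
  distortion constant be a closed term.\<close>

locale markov_map_constants = expanding_markov_map +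
  fixes \<theta> \<kappa> \<eta> :: real
  assumes \<theta>_pos: "\<theta> > 0" and a_step: "\<And>j. a j < a (j + 1)" "\<And>j. a (j + 1) - a j \<le> \<theta>"
    and \<kappa>_gt_1: "\<kappa> > 1" and deriv_lower: "\<And>j x. x \<in> markov_interval a j \<Longrightarrow> \<kappa> \<le> \<bar>\<tau>' j x\<bar>"
    and \<eta>_pos: "\<eta> > 0"
    and deriv2_bound: "\<And>j x. x \<in> markov_interval a j \<Longrightarrow> \<bar>\<tau>'' j x / (\<tau>' j x)\<^sup>2\<bar> \<le> \<eta>"
begin

definition cell :: "int \<Rightarrow> real set" where
  "cell j = {a j<..<a (j + 1)}"

text \<open>One point suffices: by the Markov property the image of a cell that meets
  \<open>cell j\<close> covers it. In this form an edge can be read off any orbit that avoids the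
  endpoints.\<close>

definition edge :: "int \<Rightarrow> int \<Rightarrow> bool" where
  "edge i j \<longleftrightarrow> (\<exists>x\<in>cell i. T x \<in> cell j)"

text \<open>A word of \<open>n + 1\<close> letters prescribes the cells at times 0 to
  \<open>n\<close>, so it belongs to \<open>T ^^ n\<close>; this explains the exponent
  \<open>length w - 1\<close> below.\<close>

fun cyl :: "int list \<Rightarrow> real set" where
  "cyl [] = UNIV"
| "cyl (i # w) = cell i \<inter> T -` cyl w"

lemma a_strict_mono: "strict_mono a"
proof (rule strict_monoI)
  show "a i < a j" if "i < j" for i j
    using that
  proof (induction j rule: int_gr_induct)
    case (step j)
    then show ?case using a_step(1)[of j] by (auto intro: order.strict_trans)
  qed (use a_step in auto)
qed

lemma a_less_iff [simp]: "a i < a j \<longleftrightarrow> i < j"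
  by (rule strict_mono_less[OF a_strict_mono])

lemma a_le_iff [simp]: "a i \<le> a j \<longleftrightarrow> i \<le> j"
  by (rule strict_mono_less_eq[OF a_strict_mono])

lemma cell_unique: "x \<in> cell i \<Longrightarrow> x \<in> cell j \<Longrightarrow> i = j"
proof -
  assume "x \<in> cell i" "x \<in> cell j"
  then have "a i < a (j + 1)" "a j < a (i + 1)" by (auto simp: cell_def simp del: a_less_iff)
  then show "i = j" by simp
qed

lemma cell_exists:
  assumes "x \<notin> range a"
  obtains j where "x \<in> cell j"
proof -
  obtain j0 where j0: "a j0 \<le> x"
    using a_at_bot unfolding filterlim_at_bot by (meson eventually_at_bot_linorder order_refl)
  obtain j1 where j1: "\<And>j. j \<ge> j1 \<Longrightarrow> x + 1 \<le> a j"
    using a_at_top unfolding filterlim_at_top by (meson eventually_at_top_linorder)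
  define n where "n = (LEAST n. x < a (j0 + int n))"
  have ex: "x < a (j0 + int (nat (\<bar>j1 - j0\<bar>)))" using j1[of "j0 + int (nat (\<bar>j1 - j0\<bar>))"] by fastforce
  then have n: "x < a (j0 + int n)" unfolding n_def by (rule LeastI)
  then have "n \<noteq> 0" using j0 by (intro notI) simp
  then obtain m where m: "n = Suc m" by (cases n) auto
  have "\<not> x < a (j0 + int m)" using not_less_Least[of m "\<lambda>n. x < a (j0 + int n)"] m n_def by auto
  moreover have "x \<noteq> a (j0 + int m)" using assms by auto
  ultimately have "x \<in> cell (j0 + int m)" using n m by (auto simp: cell_def algebra_simps)
  then show ?thesis by (rule that)
qed

lemma cell_subset_markov: "cell j \<subseteq> markov_interval a j"
  by (auto simp: cell_def markov_interval_def)

lemma markov_interval_diff_cell: "markov_interval a j - cell j \<subseteq> range a"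
  by (auto simp: cell_def markov_interval_def)

lemma T_eq: "x \<in> cell i \<Longrightarrow> T x = \<tau> i x"
  using A2_extends by (auto simp: cell_def)

lemma branch_image:
  obtains p q where "p \<le> q" "\<tau> i ` markov_interval a i = {a p..a (q + 1)}"
    "inj_on (\<tau> i) (markov_interval a i)"
proof -
  obtain p q where pq: "p \<le> q" and bij: "bij_betw (\<tau> i) (markov_interval a i) (\<Union>k\<in>{p..q}. markov_interval a k)"
    using A2_bij by blast
  have "(\<Union>k\<in>{p..q}. markov_interval a k) = {a p..a (q + 1)}"
    using pq
  proof (induction q rule: int_ge_induct)
    case base
    then show ?case by (simp add: markov_interval_def)
  next
    case (step q)
    have "{p..q + 1} = insert (q + 1) {p..q}" using step by auto
    then have "(\<Union>k\<in>{p..q + 1}. markov_interval a k) = markov_interval a (q + 1) \<union> {a p..a (q + 1)}"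
      using step by auto
    also have "\<dots> = {a p..a (q + 1 + 1)}"
      using step ivl_disj_un_two_touch(4)[of "a p" "a (q + 1)" "a (q + 1 + 1)"]
      by (auto simp: markov_interval_def)
    finally show ?case .
  qed
  with bij pq show ?thesis by (intro that[of p q]) (auto simp: bij_betw_def)
qed

lemma branch_continuous: "continuous_on (markov_interval a i) (\<tau> i)"
  using A2_deriv by (meson DERIV_continuous continuous_on_eq_continuous_within)

lemma T_inj_on_cell: "inj_on T (cell i)"
proof (rule branch_image[of i])
  assume "inj_on (\<tau> i) (markov_interval a i)"
  then have "inj_on (\<tau> i) (cell i)" using cell_subset_markov by (rule inj_on_subset)
  then show ?thesis by (simp add: T_eq cong: inj_on_cong)
qed

text \<open>The last property is the distortion of a single step: (A4) bounds the derivative of the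
  logarithm of the branch derivative, taken as a function of the image point.\<close>

lemma inverse_branch:
  assumes "edge i j"
  obtains \<phi> \<phi>' where
    "\<And>y. y \<in> cell j \<Longrightarrow> \<phi> y \<in> cell i \<and> T (\<phi> y) = y"
    "\<And>y. y \<in> cell j \<Longrightarrow> (\<phi> has_real_derivative \<phi>' y) (at y)"
    "\<And>y. y \<in> cell j \<Longrightarrow> 0 < \<bar>\<phi>' y\<bar> \<and> \<bar>\<phi>' y\<bar> \<le> 1 / \<kappa>"
    "\<And>y z. y \<in> cell j \<Longrightarrow> z \<in> cell j \<Longrightarrow> \<bar>\<phi>' y\<bar> \<le> \<bar>\<phi>' z\<bar> * exp (\<eta> * \<bar>y - z\<bar>)"
proof -
  obtain p q where pq: "p \<le> q" "\<tau> i ` markov_interval a i = {a p..a (q + 1)}"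
    and inj: "inj_on (\<tau> i) (markov_interval a i)" by (rule branch_image)
  obtain x0 where x0: "x0 \<in> cell i" "\<tau> i x0 \<in> cell j"
    using assms T_eq unfolding edge_def by force
  have "\<tau> i x0 \<in> {a p..a (q + 1)}" using x0(1) cell_subset_markov pq(2) by blast
  then have "a p < a (j + 1)" "a j < a (q + 1)" using x0(2) by (auto simp: cell_def simp del: a_less_iff)
  then have jpq: "p \<le> j" "j \<le> q" by auto
  have between: "a p < y \<and> y < a (q + 1)" if "y \<in> cell j" for y
  proof -
    have "a p \<le> a j" "a (j + 1) \<le> a (q + 1)" using jpq by auto
    then show ?thesis using that by (auto simp: cell_def simp del: a_le_iff)
  qed
  define \<phi> where "\<phi> = the_inv_into (markov_interval a i) (\<tau> i)"
  have comp: "compact (markov_interval a i)" by (simp add: markov_interval_def)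
  have cont: "continuous_on {a p..a (q + 1)} \<phi>"
    using continuous_on_inv_into[OF branch_continuous comp inj] by (simp add: \<phi>_def pq)
  have \<phi>1: "\<phi> y \<in> markov_interval a i" "\<tau> i (\<phi> y) = y" if "y \<in> {a p..a (q + 1)}" for y
    using that the_inv_into_into[OF inj, of y] f_the_inv_into_f[OF inj, of y]
    by (auto simp: \<phi>_def pq)
  have \<phi>_cell: "\<phi> y \<in> cell i" if y: "y \<in> cell j" for y
  proof -
    have "a p \<in> {a p..a (q + 1)}" "a (q + 1) \<in> {a p..a (q + 1)}" "y \<in> {a p..a (q + 1)}"
      using pq(1) between[OF y] by auto
    then show ?thesis
      using continuous_inj_image_between_imp_interior[of "a i" "a (i + 1)" "\<tau> i" "\<phi> (a p)" "\<phi> (a (q + 1))" "\<phi> y"]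
        branch_continuous[of i] inj \<phi>1 between[OF y]
      unfolding markov_interval_def cell_def by auto
  qed
  have \<tau>\<phi>: "\<tau> i (\<phi> y) = y" if "y \<in> cell j" for y
    using between[OF that] \<phi>1(2)[of y] by auto
  have ne: "\<tau>' i x \<noteq> 0" if "x \<in> cell i" for x
    using deriv_lower[of x i] \<kappa>_gt_1 that cell_subset_markov by force
  have at: "at x within markov_interval a i = at x" if "x \<in> cell i" for x
    using that by (intro at_within_interior) (auto simp: markov_interval_def cell_def)
  define \<phi>' where "\<phi>' y = inverse (\<tau>' i (\<phi> y))" for y
  have op: "open (cell j)" by (simp add: cell_def)
  have der: "(\<phi> has_real_derivative \<phi>' y) (at y)" if y: "y \<in> cell j" for y
    unfolding \<phi>'_def
  proof (rule has_field_derivative_inverse_basic[OF _ _ _ op y])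
    show "(\<tau> i has_real_derivative \<tau>' i (\<phi> y)) (at (\<phi> y))"
      using A2_deriv at[OF \<phi>_cell[OF y]] \<phi>_cell[OF y] cell_subset_markov by (metis subsetD)
    show "\<tau>' i (\<phi> y) \<noteq> 0" using ne \<phi>_cell[OF y] by auto
    have "continuous_on (cell j) \<phi>"
      by (rule continuous_on_subset[OF cont]) (use between in force)
    then show "continuous (at y) \<phi>" using op y by (simp add: continuous_on_eq_continuous_at)
  qed (rule \<tau>\<phi>)
  have abs\<phi>': "0 < \<bar>\<phi>' y\<bar> \<and> \<bar>\<phi>' y\<bar> \<le> 1 / \<kappa>" if y: "y \<in> cell j" for y
    using ne[OF \<phi>_cell[OF y]] deriv_lower[of "\<phi> y" i] \<phi>_cell[OF y] cell_subset_markov[of i] \<kappa>_gt_1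
    by (auto simp: \<phi>'_def abs_inverse divide_simps)
  \<comment> \<open>Squaring avoids a case distinction on the sign of \<open>\<tau>'\<close>. As
    \<open>\<phi>'\<close> is the reciprocal of \<open>\<tau>'\<close>, differentiating
    \<open>g\<close> gives twice the quotient in (A4), so \<open>g\<close> is Lipschitz with
    constant \<open>2 * \<eta>\<close>.\<close>
  define g where "g y = ln ((\<tau>' i (\<phi> y))\<^sup>2)" for y
  have dg: "(g has_real_derivative 2 * \<tau>'' i (\<phi> y) / (\<tau>' i (\<phi> y))\<^sup>2) (at y within cell j)"
    if y: "y \<in> cell j" for y
  proof -
    note ne[OF \<phi>_cell[OF y], simp]
    have 1: "(\<tau>' i has_real_derivative \<tau>'' i (\<phi> y)) (at (\<phi> y))"
      using A2_deriv2 at[OF \<phi>_cell[OF y]] \<phi>_cell[OF y] cell_subset_markov by (metis subsetD)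
    have 2: "((\<lambda>y. \<tau>' i (\<phi> y)) has_real_derivative \<tau>'' i (\<phi> y) * \<phi>' y) (at y)"
      by (rule DERIV_chain2[OF 1 der[OF y]])
    have "(g has_real_derivative 2 * \<tau>'' i (\<phi> y) / (\<tau>' i (\<phi> y))\<^sup>2) (at y)"
      unfolding g_def
      by (rule derivative_eq_intros 2 refl | simp)+ (simp add: \<phi>'_def field_simps power2_eq_square)
    then show ?thesis by (rule has_field_derivative_at_within)
  qed
  have lip: "\<bar>g y - g z\<bar> \<le> 2 * \<eta> * \<bar>y - z\<bar>" if "y \<in> cell j" "z \<in> cell j" for y z
  proof -
    have "norm (g y - g z) \<le> (2 * \<eta>) * norm (y - z)"
    proof (rule field_differentiable_bound[OF _ dg _ that])
      show "convex (cell j)" by (simp add: cell_def)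
      show "norm (2 * \<tau>'' i (\<phi> u) / (\<tau>' i (\<phi> u))\<^sup>2) \<le> 2 * \<eta>" if "u \<in> cell j" for u
      proof -
        have "\<bar>\<tau>'' i (\<phi> u) / (\<tau>' i (\<phi> u))\<^sup>2\<bar> \<le> \<eta>"
          using deriv2_bound \<phi>_cell[OF that] cell_subset_markov by blast
        then show ?thesis by (simp add: abs_mult)
      qed
    qed
    then show ?thesis by simp
  qed
  have dist: "\<bar>\<phi>' y\<bar> \<le> \<bar>\<phi>' z\<bar> * exp (\<eta> * \<bar>y - z\<bar>)" if yz: "y \<in> cell j" "z \<in> cell j" for y z
  proof -
    have expr: "\<bar>\<phi>' u\<bar> = exp (- g u / 2)" if "u \<in> cell j" for u
    proof -
      note [simp] = ne[OF \<phi>_cell[OF that]]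
      have "g u = 2 * ln \<bar>\<tau>' i (\<phi> u)\<bar>"
        unfolding g_def using ln_realpow[of "\<bar>\<tau>' i (\<phi> u)\<bar>" 2] by simp
      then show ?thesis by (simp add: \<phi>'_def exp_minus abs_inverse)
    qed
    have "- g y / 2 \<le> - g z / 2 + \<eta> * \<bar>y - z\<bar>" using lip[OF yz] by linarith
    then show ?thesis using yz by (simp add: expr flip: exp_add)
  qed
  show ?thesis
    by (rule that[of \<phi> \<phi>']) (use \<phi>_cell \<tau>\<phi> T_eq[OF \<phi>_cell] der abs\<phi>' dist in auto)
qed

lemma cyl_subset_cell_last:
  "w \<noteq> [] \<Longrightarrow> x \<in> cyl w \<Longrightarrow> (T ^^ (length w - 1)) x \<in> cell (last w)"
proof (induction w arbitrary: x)
  case (Cons i w)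
  show ?case
  proof (cases w)
    case (Cons j v)
    with Cons.IH[of "T x"] Cons.prems show ?thesis by (auto simp: funpow_swap1 split: if_splits)
  qed (use Cons in auto)
qed simp

lemma inj_on_cyl: "w \<noteq> [] \<Longrightarrow> inj_on (T ^^ (length w - 1)) (cyl w)"
proof (induction w)
  case (Cons i w)
  show ?case
  proof (cases w)
    case (Cons j v)
    show ?thesis
    proof (rule inj_onI)
      fix x y assume xy: "x \<in> cyl (i # w)" "y \<in> cyl (i # w)"
        "(T ^^ (length (i # w) - 1)) x = (T ^^ (length (i # w) - 1)) y"
      then have "(T ^^ (length w - 1)) (T x) = (T ^^ (length w - 1)) (T y)" "T x \<in> cyl w" "T y \<in> cyl w"
        by (auto simp: Cons funpow_swap1)
      then have "T x = T y" using Cons.IH Cons by (auto dest: inj_onD)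
      then show "x = y" using T_inj_on_cell[of i] xy by (auto dest: inj_onD)
    qed
  qed (auto intro: inj_on_subset)
qed simp

text \<open>A new first letter composes its inverse branch on the outside. The earlier branches have
  already contracted distances by \<open>(1 / \<kappa>) ^ n\<close> when the distortion of the new
  one is measured, which adds one term to the geometric sum.\<close>

lemma inverse_branch_cyl:
  assumes "w \<noteq> []" "successively edge w"
  obtains \<psi> \<psi>' where
    "\<And>y. y \<in> cell (last w) \<Longrightarrow> \<psi> y \<in> cyl w \<and> (T ^^ (length w - 1)) (\<psi> y) = y"
    "\<And>y. y \<in> cell (last w) \<Longrightarrow> (\<psi> has_real_derivative \<psi>' y) (at y)"
    "\<And>y. y \<in> cell (last w) \<Longrightarrow> 0 < \<bar>\<psi>' y\<bar> \<and> \<bar>\<psi>' y\<bar> \<le> (1 / \<kappa>) ^ (length w - 1)"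
    "\<And>y z. y \<in> cell (last w) \<Longrightarrow> z \<in> cell (last w) \<Longrightarrow>
        \<bar>\<psi>' y\<bar> \<le> \<bar>\<psi>' z\<bar> * exp ((\<Sum>i<length w - 1. \<eta> * (1 / \<kappa>) ^ i) * \<bar>y - z\<bar>)"
  using assms
proof (induction w arbitrary: thesis)
  case (Cons i w)
  show ?case
  proof (cases "w = []")
    case True
    then show ?thesis by (intro Cons.prems(1)[of "\<lambda>x. x" "\<lambda>x. 1"]) auto
  next
    case False
    then have e: "edge i (hd w)" "successively edge w" using Cons.prems by (auto simp: successively_Cons)
    define n where "n = length w - 1"
    define k where "k = last w"
    have len: "length w = Suc n" "last (i # w) = k" using False by (auto simp: n_def k_def)
    obtain \<psi> \<psi>' where \<psi>: "\<And>y. y \<in> cell k \<Longrightarrow> \<psi> y \<in> cyl w \<and> (T ^^ n) (\<psi> y) = y"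
      and d\<psi>: "\<And>y. y \<in> cell k \<Longrightarrow> (\<psi> has_real_derivative \<psi>' y) (at y)"
      and b\<psi>: "\<And>y. y \<in> cell k \<Longrightarrow> 0 < \<bar>\<psi>' y\<bar> \<and> \<bar>\<psi>' y\<bar> \<le> (1 / \<kappa>) ^ n"
      and dist\<psi>: "\<And>y z. y \<in> cell k \<Longrightarrow> z \<in> cell k \<Longrightarrow>
          \<bar>\<psi>' y\<bar> \<le> \<bar>\<psi>' z\<bar> * exp ((\<Sum>i<n. \<eta> * (1 / \<kappa>) ^ i) * \<bar>y - z\<bar>)"
      using Cons.IH[OF _ False e(2)] unfolding n_def k_def by blast
    obtain \<phi> \<phi>' where \<phi>: "\<And>y. y \<in> cell (hd w) \<Longrightarrow> \<phi> y \<in> cell i \<and> T (\<phi> y) = y"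
      and d\<phi>: "\<And>y. y \<in> cell (hd w) \<Longrightarrow> (\<phi> has_real_derivative \<phi>' y) (at y)"
      and b\<phi>: "\<And>y. y \<in> cell (hd w) \<Longrightarrow> 0 < \<bar>\<phi>' y\<bar> \<and> \<bar>\<phi>' y\<bar> \<le> 1 / \<kappa>"
      and dist\<phi>: "\<And>y z. y \<in> cell (hd w) \<Longrightarrow> z \<in> cell (hd w) \<Longrightarrow> \<bar>\<phi>' y\<bar> \<le> \<bar>\<phi>' z\<bar> * exp (\<eta> * \<bar>y - z\<bar>)"
      using inverse_branch[OF e(1)] by blast
    have hd: "\<psi> y \<in> cell (hd w)" if "y \<in> cell k" for y
      using \<psi>[OF that] False by (cases w) auto
    have cv: "convex (cell k)" by (simp add: cell_def)
    have lip: "\<bar>\<psi> y - \<psi> z\<bar> \<le> (1 / \<kappa>) ^ n * \<bar>y - z\<bar>" if "y \<in> cell k" "z \<in> cell k" for y z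
      using field_differentiable_bound[OF cv has_field_derivative_at_within[OF d\<psi>], of "(1 / \<kappa>) ^ n" y z]
        that b\<psi> by auto
    show ?thesis
    proof (rule Cons.prems(1)[of "\<lambda>y. \<phi> (\<psi> y)" "\<lambda>y. \<phi>' (\<psi> y) * \<psi>' y"]; (unfold len)?)
      fix y assume y: "y \<in> cell k"
      show "\<phi> (\<psi> y) \<in> cyl (i # w) \<and> (T ^^ (length (i # w) - 1)) (\<phi> (\<psi> y)) = y"
        using \<psi>[OF y] \<phi>[OF hd[OF y]] by (simp add: len funpow_swap1 del: funpow.simps) (simp add: funpow_swap1)
      show "((\<lambda>y. \<phi> (\<psi> y)) has_real_derivative \<phi>' (\<psi> y) * \<psi>' y) (at y)"
        by (rule DERIV_chain2[OF d\<phi>[OF hd[OF y]] d\<psi>[OF y]])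
      have "\<bar>\<phi>' (\<psi> y) * \<psi>' y\<bar> \<le> 1 / \<kappa> * (1 / \<kappa>) ^ n"
        unfolding abs_mult using b\<phi>[OF hd[OF y]] b\<psi>[OF y] \<kappa>_gt_1 by (intro mult_mono) auto
      then show "0 < \<bar>\<phi>' (\<psi> y) * \<psi>' y\<bar> \<and> \<bar>\<phi>' (\<psi> y) * \<psi>' y\<bar> \<le> (1 / \<kappa>) ^ (length (i # w) - 1)"
        using b\<phi>[OF hd[OF y]] b\<psi>[OF y] by (auto simp: len abs_mult)
    next
      fix y z assume yz: "y \<in> cell k" "z \<in> cell k"
      have "\<bar>\<phi>' (\<psi> y)\<bar> \<le> \<bar>\<phi>' (\<psi> z)\<bar> * exp (\<eta> * \<bar>\<psi> y - \<psi> z\<bar>)"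
        using dist\<phi> hd yz by blast
      also have "\<dots> \<le> \<bar>\<phi>' (\<psi> z)\<bar> * exp (\<eta> * ((1 / \<kappa>) ^ n * \<bar>y - z\<bar>))"
        using lip[OF yz] \<eta>_pos by (intro mult_left_mono) auto
      finally have 1: "\<bar>\<phi>' (\<psi> y)\<bar> \<le> \<bar>\<phi>' (\<psi> z)\<bar> * exp (\<eta> * ((1 / \<kappa>) ^ n * \<bar>y - z\<bar>))" .
      have "\<bar>\<phi>' (\<psi> y) * \<psi>' y\<bar> \<le> (\<bar>\<phi>' (\<psi> z)\<bar> * exp (\<eta> * ((1 / \<kappa>) ^ n * \<bar>y - z\<bar>))) *
          (\<bar>\<psi>' z\<bar> * exp ((\<Sum>i<n. \<eta> * (1 / \<kappa>) ^ i) * \<bar>y - z\<bar>))"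
        unfolding abs_mult using 1 dist\<psi>[OF yz] by (intro mult_mono) auto
      also have "\<dots> = \<bar>\<phi>' (\<psi> z) * \<psi>' z\<bar> * exp ((\<Sum>i<length (i # w) - 1. \<eta> * (1 / \<kappa>) ^ i) * \<bar>y - z\<bar>)"
        by (simp add: len abs_mult algebra_simps exp_add)
      finally show "\<bar>\<phi>' (\<psi> y) * \<psi>' y\<bar> \<le> \<bar>\<phi>' (\<psi> z) * \<psi>' z\<bar> *
          exp ((\<Sum>i<length (i # w) - 1. \<eta> * (1 / \<kappa>) ^ i) * \<bar>y - z\<bar>)" .
    qed
  qed
qed simp

section \<open>Measurability and null sets under \<open>T\<close>\<close>

lemma cell_open [simp]: "open (cell j)" and cell_convex [simp]: "convex (cell j)"
  and cell_borel [measurable]: "cell j \<in> sets borel" and cell_bounded [simp]: "bounded (cell j)"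
  by (auto simp: cell_def)

lemma measure_cell_pos: "0 < measure lborel (cell j)"
  using a_step(1)[of j] by (simp add: cell_def)

lemma cell_not_null: "\<not> (AE x in lborel. x \<notin> cell k)"
  using measure_cell_pos[of k] by (auto simp: AE_iff_measurable[OF _ refl] measure_def)

lemma countable_range_a [simp]: "countable (range a)"
  by simp

lemma T_continuous_on_cell: "continuous_on (cell i) T"
  by (rule continuous_on_eq[OF continuous_on_subset[OF branch_continuous cell_subset_markov[of i]]])
    (simp add: T_eq)

lemma T_differentiable_on_cell: "T differentiable_on (cell i)"
proof -
  have "\<tau> i differentiable_on (markov_interval a i)"
    using A2_deriv unfolding differentiable_on_def real_differentiable_def by blast
  then have "\<tau> i differentiable_on (cell i)" using cell_subset_markov by (rule differentiable_on_subset)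
  then show ?thesis
    unfolding differentiable_on_def
    by (auto intro: differentiable_transform_within[OF _ zero_less_one] simp: T_eq)
qed

lemma cell_cover: "x \<in> range a \<or> (\<exists>j. x \<in> cell j)"
  using cell_exists by metis

text \<open>\<open>T\<close> is continuous on each open cell, and its arbitrary values at the
  endpoints change a preimage only by a countable set.\<close>

lemma T_measurable [measurable]: "T \<in> borel_measurable borel"
proof (rule borel_measurableI)
  fix S :: "real set" assume S: "open S"
  have "T -` S = (\<Union>j. cell j \<inter> T -` S) \<union> (range a \<inter> T -` S)"
    using cell_cover by blast
  moreover have "open (cell j \<inter> T -` S)" for j
    using continuous_open_preimage[OF T_continuous_on_cell _ S] by simp
  moreover have "range a \<inter> T -` S \<in> sets borel"
    by (rule sets.countable[OF _ countable_subset[OF _ countable_range_a]]) auto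
  moreover have "open (\<Union>j. cell j \<inter> T -` S)" using calculation(2) by blast
  ultimately show "T -` S \<inter> space borel \<in> sets borel" by (metis borel_open inf_top_right sets.Un space_borel)
qed

lemma T_iterate_measurable [measurable]: "T ^^ n \<in> borel_measurable borel"
  by (rule measurable_compose_n[OF T_measurable])

lemma AE_not_range_a: "AE x in lborel. x \<notin> range a"
  unfolding AE_lborel_iff_negligible by (simp add: countable_imp_negligible)

text \<open>Over each target cell the preimage is the image of a null set under a differentiable
  inverse branch. Points sent to an endpoint are countably many because \<open>T\<close> is
  injective on the cell.\<close>

lemma negligible_preimage_cell:
  assumes N: "negligible N"
  shows "negligible (cell i \<inter> T -` N)"
proof -
  have "countable (cell i \<inter> T -` range a)"
  proof (rule countable_image_inj_on)
    show "countable (T ` (cell i \<inter> T -` range a))" by (rule countable_subset[OF _ countable_range_a]) auto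
    show "inj_on T (cell i \<inter> T -` range a)" by (rule inj_on_subset[OF T_inj_on_cell]) auto
  qed
  moreover have "negligible (cell i \<inter> T -` (N \<inter> cell j))" for j
  proof (cases "edge i j")
    case True
    obtain \<phi> \<phi>' where \<phi>: "\<And>y. y \<in> cell j \<Longrightarrow> \<phi> y \<in> cell i \<and> T (\<phi> y) = y"
      and d: "\<And>y. y \<in> cell j \<Longrightarrow> (\<phi> has_real_derivative \<phi>' y) (at y)"
      using inverse_branch[OF True] by metis
    have "\<phi> differentiable_on (N \<inter> cell j)"
      unfolding differentiable_on_def
      using d has_field_derivative_at_within by (fastforce simp: real_differentiable_def)
    then have "negligible (\<phi> ` (N \<inter> cell j))"
      by (rule negligible_differentiable_image_negligible[OF order_refl negligible_Int[OF disjI1[OF N]]])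
    moreover have "x = \<phi> (T x)" if "x \<in> cell i" "T x \<in> cell j" for x
      using \<phi>[OF that(2)] that T_inj_on_cell[of i] by (metis inj_onD)
    ultimately show ?thesis by (elim negligible_subset) fastforce
  next
    case False
    then have "cell i \<inter> T -` (N \<inter> cell j) = {}" by (auto simp: edge_def)
    then show ?thesis by simp
  qed
  then have "negligible (\<Union>j. cell i \<inter> T -` (N \<inter> cell j))" by (intro negligible_countable_Union) auto
  ultimately have "negligible ((cell i \<inter> T -` range a) \<union> (\<Union>j. cell i \<inter> T -` (N \<inter> cell j)))"
    by (intro negligible_Un[OF countable_imp_negligible])
  moreover have "x \<in> (cell i \<inter> T -` range a) \<union> (\<Union>j. cell i \<inter> T -` (N \<inter> cell j))"
    if "x \<in> cell i \<inter> T -` N" for x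
    using that cell_cover[of "T x"] by blast
  ultimately show ?thesis by (meson negligible_subset subsetI)
qed

lemma AE_T:
  assumes "AE x in lborel. P x"
  shows "AE x in lborel. P (T x)"
proof -
  have "negligible (cell i \<inter> T -` {x. \<not> P x})" for i
    using assms unfolding AE_lborel_iff_negligible by (rule negligible_preimage_cell)
  then have "negligible (\<Union>i. cell i \<inter> T -` {x. \<not> P x})"
    by (intro negligible_countable_Union) auto
  then have "negligible (range a \<union> (\<Union>i. cell i \<inter> T -` {x. \<not> P x}))"
    by (intro negligible_Un[OF countable_imp_negligible]) auto
  moreover have "x \<in> range a \<union> (\<Union>i. cell i \<inter> T -` {x. \<not> P x})" if "\<not> P (T x)" for x
    using that cell_cover[of x] by blast
  ultimately show ?thesis unfolding AE_lborel_iff_negligible by (elim negligible_subset) blast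
qed

lemma AE_T_iterate: "(AE x in lborel. P x) \<Longrightarrow> AE x in lborel. P ((T ^^ n) x)"
proof (induction n arbitrary: P)
  case (Suc n)
  from Suc.IH[OF AE_T[OF Suc.prems]] show ?case by simp
qed simp

lemma AE_T_iterates: "(AE x in lborel. P x) \<Longrightarrow> AE x in lborel. \<forall>n. P ((T ^^ n) x)"
  by (simp add: AE_all_countable AE_T_iterate)

text \<open>That images of null sets are null is stated through all preimages of a typical point. In
  this form forward images can be handled without asking whether they are measurable.\<close>

lemma AE_T_image:
  assumes "AE x in lborel. P x"
  shows "AE y in lborel. \<forall>x. T x = y \<longrightarrow> P x"
proof -
  have "negligible (T ` (cell i \<inter> {x. \<not> P x}))" for i
    using assms
    by (intro negligible_differentiable_image_negligible differentiable_on_subset[OF T_differentiable_on_cell])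
      (auto simp: AE_lborel_iff_negligible intro: negligible_Int)
  then have "negligible (\<Union>i. T ` (cell i \<inter> {x. \<not> P x}))" by (intro negligible_countable_Union) auto
  then have "negligible (T ` range a \<union> (\<Union>i. T ` (cell i \<inter> {x. \<not> P x})))"
    by (intro negligible_Un[OF countable_imp_negligible]) auto
  moreover have "T x \<in> T ` range a \<union> (\<Union>i. T ` (cell i \<inter> {x. \<not> P x}))" if "\<not> P x" for x
    using that cell_cover[of x] by blast
  ultimately show ?thesis unfolding AE_lborel_iff_negligible by (elim negligible_subset) blast
qed

lemma AE_T_iterate_image: "(AE x in lborel. P x) \<Longrightarrow> AE y in lborel. \<forall>x. (T ^^ n) x = y \<longrightarrow> P x"
proof (induction n arbitrary: P)
  case (Suc n)
  from Suc.IH[OF AE_T_image[OF Suc.prems]] show ?case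
    by eventually_elim (auto simp: funpow_swap1)
qed simp

section \<open>Itineraries of orbits that avoid the endpoints\<close>

definition good :: "real \<Rightarrow> bool" where
  "good x \<longleftrightarrow> (\<forall>n. (T ^^ n) x \<notin> range a)"

definition idx :: "real \<Rightarrow> int" where
  "idx x = (THE j. x \<in> cell j)"

definition itin :: "real \<Rightarrow> nat \<Rightarrow> int list" where
  "itin x n = map (\<lambda>i. idx ((T ^^ i) x)) [0..<Suc n]"

lemma AE_good: "AE x in lborel. good x"
  unfolding good_def by (rule AE_T_iterates[OF AE_not_range_a])

lemma good_T: "good x \<Longrightarrow> good (T x)"
  unfolding good_def by (metis comp_apply funpow_Suc_right)

lemma good_iterate: "good x \<Longrightarrow> good ((T ^^ n) x)"
  by (induction n) (auto intro: good_T)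

lemma idx_eq: "x \<in> cell j \<Longrightarrow> idx x = j"
  unfolding idx_def using cell_unique by blast

lemma good_cell: "good x \<Longrightarrow> x \<in> cell (idx x)"
proof -
  assume "good x"
  then have "x \<notin> range a" unfolding good_def by (metis funpow_0)
  then show ?thesis by (rule cell_exists) (simp add: idx_eq)
qed

lemma good_cell_iff: "good x \<Longrightarrow> x \<in> cell j \<longleftrightarrow> idx x = j"
  using good_cell idx_eq by blast

lemma itin_0: "itin x 0 = [idx x]" and itin_Suc: "itin x (Suc n) = idx x # itin (T x) n"
  unfolding itin_def by (simp, subst upt_conv_Cons) (auto simp: map_Suc_upt[symmetric] funpow_swap1 simp del: upt_Suc)

lemma length_itin [simp]: "length (itin x n) = Suc n" and itin_nonempty [simp]: "itin x n \<noteq> []"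
  and hd_itin [simp]: "hd (itin x n) = idx x" and last_itin [simp]: "last (itin x n) = idx ((T ^^ n) x)"
  by (auto simp: itin_def hd_map last_map simp del: upt_Suc)

lemma good_itin: "good x \<Longrightarrow> x \<in> cyl (itin x n) \<and> successively edge (itin x n)"
proof (induction n arbitrary: x)
  case (Suc n)
  have "edge (idx x) (idx (T x))" using good_cell Suc.prems good_T unfolding edge_def by blast
  then show ?case using Suc.IH[OF good_T[OF Suc.prems]] good_cell[OF Suc.prems]
    by (auto simp: itin_Suc successively_Cons)
qed (auto simp: itin_0 good_cell)

lemma relpowp_edge_word:
  "(edge ^^ n) i j \<longleftrightarrow> (\<exists>w. length w = Suc n \<and> hd w = i \<and> last w = j \<and> successively edge w)"
proof (induction n arbitrary: i)
  case 0
  show ?case by (auto simp: length_Suc_conv intro!: exI[of _ "[i]"])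
next
  case (Suc n)
  show ?case
  proof
    assume "(edge ^^ Suc n) i j"
    then obtain k where k: "edge i k" "(edge ^^ n) k j" using relpowp_Suc_D2 by metis
    then obtain w where "length w = Suc n" "hd w = k" "last w = j" "successively edge w" using Suc.IH by blast
    then show "\<exists>w. length w = Suc (Suc n) \<and> hd w = i \<and> last w = j \<and> successively edge w"
      using k by (intro exI[of _ "i # w"]) (auto simp: successively_Cons)
  next
    assume "\<exists>w. length w = Suc (Suc n) \<and> hd w = i \<and> last w = j \<and> successively edge w"
    then obtain w where w: "length w = Suc (Suc n)" "hd w = i" "last w = j" "successively edge w" by blast
    then obtain v where v: "w = i # v" "length v = Suc n" by (cases w) auto
    then have "v \<noteq> []" by auto
    then have "edge i (hd v)" "(edge ^^ n) (hd v) j" using Suc.IH w v by (auto simp: successively_Cons)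
    then show "(edge ^^ Suc n) i j" by (rule relpowp_Suc_I2)
  qed
qed

lemma good_relpowp: "good x \<Longrightarrow> (edge ^^ n) (idx x) (idx ((T ^^ n) x))"
  unfolding relpowp_edge_word using good_itin by (intro exI[of _ "itin x n"]) auto

lemma cyl_cell_hd: "w \<noteq> [] \<Longrightarrow> cyl w \<subseteq> cell (hd w)"
  by (cases w) auto

lemma cyl_borel [measurable]: "cyl w \<in> sets borel"
proof (induction w)
  case (Cons i w)
  have "T -` cyl w \<in> sets borel" using measurable_sets[OF T_measurable Cons] by simp
  then show ?case by auto
qed simp

lemma cyl_onto:
  assumes "w \<noteq> []" "successively edge w" "y \<in> cell (last w)"
  shows "\<exists>x\<in>cyl w. (T ^^ (length w - 1)) x = y"
  using inverse_branch_cyl[OF assms(1,2)] assms(3) by metis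

lemma relpowp_onto:
  assumes "(edge ^^ n) i j" "y \<in> cell j"
  shows "\<exists>x\<in>cell i. (T ^^ n) x = y"
proof -
  obtain w where w: "length w = Suc n" "hd w = i" "last w = j" "successively edge w"
    using assms(1) unfolding relpowp_edge_word by blast
  then have "w \<noteq> []" by auto
  then show ?thesis using cyl_onto[of w y] cyl_cell_hd[of w] w assms(2) by auto
qed

text \<open>This turns covering modulo null sets into pure graph theory. For the direction from
  covering to paths, almost every point of \<open>cell k\<close> has only \<open>good\<close>
  preimages under \<open>T ^^ n\<close>, and the itinerary of one of them is a path.\<close>

lemma ae_subset_markov_image_iff:
  "ae_subset (markov_interval a k) ((T ^^ n) ` markov_interval a j) \<longleftrightarrow> (edge ^^ n) j k"
proof
  assume "(edge ^^ n) j k"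
  then have "cell k \<subseteq> (T ^^ n) ` markov_interval a j"
    using relpowp_onto cell_subset_markov by blast
  moreover have "AE x in lborel. x \<notin> range a" by (rule AE_not_range_a)
  ultimately show "ae_subset (markov_interval a k) ((T ^^ n) ` markov_interval a j)"
    unfolding ae_subset_def using markov_interval_diff_cell by (auto elim!: eventually_mono)
next
  assume "ae_subset (markov_interval a k) ((T ^^ n) ` markov_interval a j)"
  then have "AE y in lborel. y \<in> markov_interval a k \<longrightarrow> y \<in> (T ^^ n) ` markov_interval a j"
    by (simp add: ae_subset_def)
  moreover have "AE y in lborel. \<forall>x. (T ^^ n) x = y \<longrightarrow> good x" by (rule AE_T_iterate_image[OF AE_good])
  ultimately have ae: "AE y in lborel. y \<in> cell k \<longrightarrow> (edge ^^ n) j k"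
  proof eventually_elim
    case (elim y)
    show ?case
    proof
      assume y: "y \<in> cell k"
      then obtain x where x: "x \<in> markov_interval a j" "(T ^^ n) x = y" using elim cell_subset_markov by blast
      then have "good x" using elim by blast
      then have "x \<notin> range a" unfolding good_def by (metis funpow_0)
      then have "x \<in> cell j" using x markov_interval_diff_cell by blast
      then show "(edge ^^ n) j k" using good_relpowp[OF \<open>good x\<close>, of n] x y by (simp add: idx_eq)
    qed
  qed
  show "(edge ^^ n) j k"
  proof (rule ccontr)
    assume no: "\<not> (edge ^^ n) j k"
    from ae have "AE y in lborel. y \<notin> cell k" by eventually_elim (use no in blast)
    then show False using cell_not_null by simp
  qed
qed

text \<open>An inverse branch changes \<open>ln \<bar>\<phi>'\<bar>\<close> by at most \<open>\<eta>\<close> times a length, and along a cylinder these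
  lengths are at most \<open>\<theta> / \<kappa> ^ i\<close>; summing the geometric series gives the constant.\<close>

definition dconst :: real where
  "dconst = exp (\<eta> * (\<kappa> / (\<kappa> - 1)) * \<theta>)"

lemma dconst_pos [simp]: "0 < dconst"
  by (simp add: dconst_def)

text \<open>The cylinder and its part over \<open>Y\<close> are images of
  \<open>cell (last w)\<close> and of \<open>Y\<close> under one inverse branch. Comparing its
  derivative with the value at a reference point \<open>z\<close> costs a factor
  \<open>dconst\<close> in the upper and in the lower bound, hence the square. The diameter bound is
  the contraction of this branch on a cell of length at most \<open>\<theta>\<close>.\<close>

lemma distortion:
  assumes w: "w \<noteq> []" "successively edge w" and Y: "Y \<in> sets borel" "Y \<subseteq> cell (last w)"
  shows "measure lborel (cyl w) * measure lborel Y \<le>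
    dconst\<^sup>2 * measure lborel (cell (last w)) * measure lborel (cyl w \<inter> (T ^^ (length w - 1)) -` Y)"
    and "0 < measure lborel (cyl w)"
    and "x \<in> cyl w \<Longrightarrow> y \<in> cyl w \<Longrightarrow> \<bar>x - y\<bar> \<le> \<theta> * (1 / \<kappa>) ^ (length w - 1)"
proof -
  define k where "k = last w"
  define n where "n = length w - 1"
  obtain \<psi> \<psi>' where \<psi>: "\<And>y. y \<in> cell k \<Longrightarrow> \<psi> y \<in> cyl w \<and> (T ^^ n) (\<psi> y) = y"
    and d\<psi>: "\<And>y. y \<in> cell k \<Longrightarrow> (\<psi> has_real_derivative \<psi>' y) (at y)"
    and b\<psi>: "\<And>y. y \<in> cell k \<Longrightarrow> 0 < \<bar>\<psi>' y\<bar> \<and> \<bar>\<psi>' y\<bar> \<le> (1 / \<kappa>) ^ n"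
    and dist\<psi>: "\<And>y z. y \<in> cell k \<Longrightarrow> z \<in> cell k \<Longrightarrow>
        \<bar>\<psi>' y\<bar> \<le> \<bar>\<psi>' z\<bar> * exp ((\<Sum>i<n. \<eta> * (1 / \<kappa>) ^ i) * \<bar>y - z\<bar>)"
    using inverse_branch_cyl[OF w] unfolding k_def n_def by blast
  have inv: "x = \<psi> ((T ^^ n) x)" "(T ^^ n) x \<in> cell k" if "x \<in> cyl w" for x
  proof -
    show "(T ^^ n) x \<in> cell k" using cyl_subset_cell_last[OF w(1) that] by (simp add: k_def n_def)
    then show "x = \<psi> ((T ^^ n) x)"
      using inj_onD[OF inj_on_cyl[OF w(1)], folded n_def] \<psi> that by metis
  qed
  have close: "\<bar>y - z\<bar> \<le> \<theta>" if "y \<in> cell k" "z \<in> cell k" for y z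
    using that a_step(2)[of k] by (auto simp: cell_def)
  have "(\<Sum>i<n. (1 / \<kappa>) ^ i) \<le> (\<Sum>i. (1 / \<kappa>) ^ i)"
    using \<kappa>_gt_1 by (intro sum_le_suminf summable_geometric) auto
  also have "\<dots> = \<kappa> / (\<kappa> - 1)" using \<kappa>_gt_1 by (subst suminf_geometric) (auto simp: field_simps)
  finally have sum: "(\<Sum>i<n. \<eta> * (1 / \<kappa>) ^ i) \<le> \<eta> * (\<kappa> / (\<kappa> - 1))"
    using \<eta>_pos unfolding sum_distrib_left[symmetric] by (intro mult_left_mono) auto
  have dist: "\<bar>\<psi>' y\<bar> \<le> \<bar>\<psi>' z\<bar> * dconst" if "y \<in> cell k" "z \<in> cell k" for y z
  proof -
    have "(\<Sum>i<n. \<eta> * (1 / \<kappa>) ^ i) * \<bar>y - z\<bar> \<le> \<eta> * (\<kappa> / (\<kappa> - 1)) * \<theta>"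
      using sum close[OF that] \<eta>_pos \<kappa>_gt_1 by (intro mult_mono) auto
    then have "exp ((\<Sum>i<n. \<eta> * (1 / \<kappa>) ^ i) * \<bar>y - z\<bar>) \<le> dconst" by (simp add: dconst_def)
    then show ?thesis using dist\<psi>[OF that] by (meson abs_ge_zero mult_left_mono order_trans)
  qed
  have lip: "\<bar>\<psi> y - \<psi> z\<bar> \<le> (1 / \<kappa>) ^ n * \<bar>y - z\<bar>" if "y \<in> cell k" "z \<in> cell k" for y z
    using field_differentiable_bound[OF cell_convex has_field_derivative_at_within[OF d\<psi>], of k "(1 / \<kappa>) ^ n" y z]
      that b\<psi> by auto
  show "\<bar>x - y\<bar> \<le> \<theta> * (1 / \<kappa>) ^ (length w - 1)" if "x \<in> cyl w" "y \<in> cyl w"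
  proof -
    have "\<bar>x - y\<bar> \<le> (1 / \<kappa>) ^ n * \<bar>(T ^^ n) x - (T ^^ n) y\<bar>"
      using lip[OF inv(2)[OF that(1)] inv(2)[OF that(2)]] inv(1)[OF that(1)] inv(1)[OF that(2)] by simp
    also have "\<dots> \<le> (1 / \<kappa>) ^ n * \<theta>"
      using close[OF inv(2)[OF that(1)] inv(2)[OF that(2)]] \<kappa>_gt_1 by (intro mult_left_mono) auto
    finally show ?thesis by (simp add: n_def mult.commute)
  qed
  have im: "cyl w \<inter> (T ^^ n) -` Y = \<psi> ` Y" if "Y \<subseteq> cell k" for Y
  proof (intro equalityI subsetI)
    fix x assume "x \<in> cyl w \<inter> (T ^^ n) -` Y"
    then have "x \<in> cyl w" "(T ^^ n) x \<in> Y" by auto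
    with inv(1) show "x \<in> \<psi> ` Y" by (intro image_eqI)
  next
    fix x assume "x \<in> \<psi> ` Y"
    then obtain y where "x = \<psi> y" "y \<in> Y" by blast
    with \<psi>[of y] that show "x \<in> cyl w \<inter> (T ^^ n) -` Y" by (simp add: subset_iff)
  qed
  have inj: "inj_on \<psi> (cell k)" using \<psi> by (metis inj_onI)
  obtain z where z: "z \<in> cell k"
    using a_step(1)[of k] by (intro that[of "(a k + a (k + 1)) / 2"]) (simp add: cell_def)
  define s where "s = \<bar>\<psi>' z\<bar>"
  have s: "0 < s" using b\<psi>[OF z] by (simp add: s_def)
  have bnd: "s / dconst \<le> \<bar>\<psi>' y\<bar> \<and> \<bar>\<psi>' y\<bar> \<le> s * dconst" if "y \<in> cell k" for y
    using dist[OF that z] dist[OF z that] by (auto simp: s_def divide_simps)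
  have bds: "s / dconst * measure lborel Y \<le> measure lborel (cyl w \<inter> (T ^^ n) -` Y)"
      "measure lborel (cyl w \<inter> (T ^^ n) -` Y) \<le> s * dconst * measure lborel Y"
    if Y: "Y \<in> sets borel" "Y \<subseteq> cell k" for Y
  proof -
    have b: "cyl w \<inter> (T ^^ n) -` Y \<in> sets borel"
      using measurable_sets[OF T_iterate_measurable Y(1), of n] by simp
    have "bounded (cyl w)" using cyl_cell_hd[OF w(1)] cell_bounded bounded_subset by blast
    then have bd: "bounded (\<psi> ` Y)" unfolding im[OF Y(2), symmetric] by (auto intro: bounded_subset)
    have bY: "bounded Y" using Y(2) cell_bounded bounded_subset by blast
    have ml: "measure lebesgue X = measure lborel X" if "X \<in> sets borel" for X :: "real set"
      using that by (simp add: measure_completion)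
    have "s / dconst * measure lebesgue Y \<le> measure lebesgue (\<psi> ` Y)"
      "measure lebesgue (\<psi> ` Y) \<le> s * dconst * measure lebesgue Y"
    proof -
      have 1: "Y \<in> sets lebesgue" "\<psi> ` Y \<in> sets lebesgue"
        using b Y(1) by (simp_all add: im[OF Y(2), symmetric])
      have 2: "(\<psi> has_real_derivative \<psi>' y) (at y within Y)" if "y \<in> Y" for y
        using d\<psi> Y(2) that by (blast intro: has_field_derivative_at_within)
      have 3: "s / dconst \<le> \<bar>\<psi>' y\<bar> \<and> \<bar>\<psi>' y\<bar> \<le> s * dconst" if "y \<in> Y" for y
        using bnd Y(2) that by blast
      note m = measure_image_bounds[OF 1(1) bY 1(2) bd 2 inj_on_subset[OF inj Y(2)] 3]
      show "s / dconst * measure lebesgue Y \<le> measure lebesgue (\<psi> ` Y)" by (rule m(1))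
      show "measure lebesgue (\<psi> ` Y) \<le> s * dconst * measure lebesgue Y" by (rule m(2))
    qed
    then show "s / dconst * measure lborel Y \<le> measure lborel (cyl w \<inter> (T ^^ n) -` Y)"
      "measure lborel (cyl w \<inter> (T ^^ n) -` Y) \<le> s * dconst * measure lborel Y"
      using b Y(1) by (simp_all add: ml im[OF Y(2), symmetric])
  qed
  have all: "cyl w \<inter> (T ^^ n) -` cell k = cyl w" using inv by auto
  have "0 < s / dconst * measure lborel (cell k)" using s measure_cell_pos[of k] by simp
  also have "\<dots> \<le> measure lborel (cyl w)" using bds(1)[of "cell k"] by (simp add: all)
  finally show "0 < measure lborel (cyl w)" .
  have "measure lborel (cyl w) * measure lborel Y \<le> (s * dconst * measure lborel (cell k)) * measure lborel Y"
    using bds(2)[of "cell k"] by (intro mult_right_mono) (auto simp: all)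
  also have "\<dots> = dconst\<^sup>2 * measure lborel (cell k) * (s / dconst * measure lborel Y)"
    by (simp add: power2_eq_square)
  also have "\<dots> \<le> dconst\<^sup>2 * measure lborel (cell k) * measure lborel (cyl w \<inter> (T ^^ n) -` Y)"
    using bds(1)[of Y] Y by (intro mult_left_mono) (auto simp: k_def)
  finally show "measure lborel (cyl w) * measure lborel Y \<le>
    dconst\<^sup>2 * measure lborel (cell (last w)) * measure lborel (cyl w \<inter> (T ^^ (length w - 1)) -` Y)"
    by (simp add: k_def n_def)
qed

subsection \<open>Recurrent and transient states\<close>

lemma T_iterate_add: "(T ^^ m) ((T ^^ n) x) = (T ^^ (m + n)) x"
  by (simp add: funpow_add)

lemma INFM_iterate: "(\<exists>\<^sub>\<infinity>m. (T ^^ m) ((T ^^ n) x) \<in> A) \<longleftrightarrow> (\<exists>\<^sub>\<infinity>m. (T ^^ m) x \<in> A)"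
  unfolding T_iterate_add cofinite_eq_sequentially frequently_def
  using eventually_sequentially_seg[of "\<lambda>m. (T ^^ m) x \<notin> A" n] by simp

text \<open>A point determines its cells letter by letter, so two cylinders are disjoint or nested.
  This is what makes the minimal cylinders of a family disjoint.\<close>

lemma cyl_prefix: "x \<in> cyl w \<Longrightarrow> x \<in> cyl v \<Longrightarrow> length w \<le> length v \<Longrightarrow> w = take (length w) v"
proof (induction w arbitrary: x v)
  case (Cons i w)
  then obtain j u where v: "v = j # u" by (cases v) auto
  have "i = j" using Cons.prems v cell_unique by auto
  moreover have "w = take (length w) u" using Cons.IH[of "T x" u] Cons.prems v by auto
  ultimately show ?case using v by simp
qed simp

lemma cyl_take: "cyl w \<subseteq> cyl (take n w)"
proof (induction w arbitrary: n)
  case (Cons i w)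
  then show ?case by (cases n) auto
qed simp

text \<open>A density argument: \<open>F\<close> is covered, up to a null set, by the disjoint minimal cylinders that
  return to \<open>cell k\<close> and lie in an open set barely larger than \<open>F\<close>; by bounded distortion \<open>F\<close> cannot
  leave out a fixed proportion of each of them.\<close>

lemma recurrence_density:
  assumes F [measurable]: "F \<in> sets borel" and Fk: "F \<subseteq> cell k" and pos: "\<not> (AE x in lborel. x \<notin> F)"
    and ret: "AE x in lborel. x \<in> F \<longrightarrow> (\<exists>\<^sub>\<infinity>n. (T ^^ n) x \<in> cell k)" and \<epsilon>: "\<epsilon> > 0"
  shows "\<exists>n\<ge>1. (edge ^^ n) k k \<and>
    (\<forall>B\<in>sets borel. (AE x in lborel. x \<in> F \<longrightarrow> (T ^^ n) x \<in> B) \<longrightarrow> measure lborel (cell k - B) \<le> \<epsilon>)"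
proof (rule ccontr)
  assume "\<not> ?thesis"
  then have "\<forall>n. \<exists>B. n \<ge> 1 \<and> (edge ^^ n) k k \<longrightarrow> B \<in> sets borel \<and>
      (AE x in lborel. x \<in> F \<longrightarrow> (T ^^ n) x \<in> B) \<and> measure lborel (cell k - B) > \<epsilon>"
    by (auto simp: not_le)
  then obtain B where B: "\<And>n. n \<ge> 1 \<Longrightarrow> (edge ^^ n) k k \<Longrightarrow> B n \<in> sets borel \<and>
      (AE x in lborel. x \<in> F \<longrightarrow> (T ^^ n) x \<in> B n) \<and> measure lborel (cell k - B n) > \<epsilon>"
    by metis
  have fin: "emeasure lborel X < \<infinity>" if "bounded X" for X :: "real set"
    using that by (rule emeasure_bounded_finite)
  have bF: "bounded F" using Fk cell_bounded bounded_subset by blast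
  have mF: "emeasure lborel F = ennreal (measure lborel F)" "0 < measure lborel F"
  proof -
    show *: "emeasure lborel F = ennreal (measure lborel F)"
      using fin[OF bF] by (intro emeasure_eq_ennreal_measure) auto
    have "emeasure lborel F \<noteq> 0" using pos by (auto simp: AE_iff_measurable[OF _ refl])
    then show "0 < measure lborel F" using * by (metis ennreal_0 zero_less_measure_iff)
  qed
  \<comment> \<open>By distortion, a part of \<open>cell k\<close> of measure more than
    \<open>\<epsilon>\<close> missed at the return time pulls back to at least the proportion
    \<open>c\<close> of the returning cylinder.\<close>
  define c where "c = \<epsilon> / (dconst\<^sup>2 * measure lborel (cell k))"
  have Dk: "0 < dconst\<^sup>2 * measure lborel (cell k)"
    using measure_cell_pos[of k] by (intro mult_pos_pos zero_less_power dconst_pos)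
  then have c: "0 < c" unfolding c_def using \<epsilon> by (intro divide_pos_pos)
  define G where "G = {w. length w \<ge> 2 \<and> hd w = k \<and> last w = k \<and> successively edge w}"
  have loss: "c * measure lborel (cyl w) \<le> measure lborel (cyl w - F)" if w: "w \<in> G" for w
  proof -
    define n where "n = length w - 1"
    have w': "w \<noteq> []" "length w = Suc n" "n \<ge> 1" "last w = k" "successively edge w"
      using w by (auto simp: G_def n_def)
    have e: "(edge ^^ n) k k" using w w' unfolding relpowp_edge_word G_def by auto
    note Bn = B[OF w'(3) e]
    have [measurable]: "B n \<in> sets borel" using Bn by blast
    have bw: "bounded (cyl w)" using cyl_cell_hd[OF w'(1)] cell_bounded bounded_subset by blast
    have "measure lborel (cyl w) * \<epsilon> \<le> measure lborel (cyl w) * measure lborel (cell k - B n)"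
      using Bn by (intro mult_left_mono) auto
    also have "\<dots> \<le> dconst\<^sup>2 * measure lborel (cell k) * measure lborel (cyl w \<inter> (T ^^ n) -` (cell k - B n))"
      using distortion(1)[OF w'(1) w'(5), of "cell k - B n"] w' by simp
    \<comment> \<open>Almost every point of \<open>F\<close> is sent into \<open>B n\<close>, so the
      points of the cylinder that are sent elsewhere lie outside \<open>F\<close> up to a null
      set.\<close>
    also have "measure lborel (cyl w \<inter> (T ^^ n) -` (cell k - B n)) \<le> measure lborel (cyl w - F)"
    proof -
      have m1: "cyl w \<inter> (T ^^ n) -` (cell k - B n) \<in> sets borel"
        using measurable_sets[OF T_iterate_measurable, of "cell k - B n" n] by simp
      have "emeasure lborel (cyl w \<inter> (T ^^ n) -` (cell k - B n)) \<le> emeasure lborel (cyl w - F)"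
      proof (rule emeasure_mono_AE)
        show "AE x in lborel. x \<in> cyl w \<inter> (T ^^ n) -` (cell k - B n) \<longrightarrow> x \<in> cyl w - F"
          using conjunct1[OF conjunct2[OF Bn]] by eventually_elim auto
      qed auto
      moreover have "bounded (cyl w - F)" using bw by (rule bounded_subset) auto
      ultimately show ?thesis unfolding measure_def using fin by (intro enn2real_mono) auto
    qed
    finally have "measure lborel (cyl w) * \<epsilon> \<le> dconst\<^sup>2 * measure lborel (cell k) * measure lborel (cyl w - F)"
      by (simp add: mult_left_mono)
    then show ?thesis using pos_divide_le_eq[OF Dk] by (simp add: c_def mult.commute)
  qed
  \<comment> \<open>The excess of \<open>U\<close> over \<open>F\<close> is chosen below
    \<open>c\<close> times the measure of \<open>F\<close>, the total loss that the disjoint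
    cylinders inside \<open>U\<close> will be shown to exceed.\<close>
  have "F \<in> sets lebesgue" by simp
  then obtain U where U: "open U" "F \<subseteq> U" "emeasure lebesgue (U - F) < ennreal (c * measure lborel F)"
    using sets_lebesgue_outer_open[of F "c * measure lborel F"] c mF(2) by (metis mult_pos_pos)
  have UF: "emeasure lborel (U - F) < ennreal (c * measure lborel F)"
    using U by (simp add: emeasure_completion)
  define H where "H = {w \<in> G. cyl w \<subseteq> U}"
  define H0 where "H0 = {w \<in> H. \<forall>n<length w. take n w \<notin> H}"
  have disj: "disjoint_family_on cyl H0"
  proof -
    have "w = v" if "w \<in> H0" "v \<in> H0" "x \<in> cyl w" "x \<in> cyl v" "length w \<le> length v" for w v x
    proof (rule ccontr)
      assume "w \<noteq> v"
      have w: "w = take (length w) v" using cyl_prefix that by blast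
      then have "length w < length v" using \<open>w \<noteq> v\<close> that(5) by (metis le_neq_implies_less take_all order_refl)
      then have "take (length w) v \<notin> H" using that(2) by (auto simp: H0_def)
      then show False using w that(1) by (auto simp: H0_def)
    qed
    then show ?thesis unfolding disjoint_family_on_def by (metis disjoint_iff linorder_linear)
  qed
  have cover: "AE x in lborel. x \<in> F \<longrightarrow> x \<in> (\<Union>w\<in>H0. cyl w)"
    using ret AE_good
  proof eventually_elim
    case (elim x)
    show ?case
    proof
      assume x: "x \<in> F"
      then obtain r where r: "r > 0" "ball x r \<subseteq> U" using U by (meson openE subsetD)
      have "(\<lambda>n. \<theta> * (1 / \<kappa>) ^ n) \<longlonglongrightarrow> \<theta> * 0"
        using \<kappa>_gt_1 by (intro tendsto_mult tendsto_const LIMSEQ_realpow_zero) auto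
      then have "eventually (\<lambda>n. \<theta> * (1 / \<kappa>) ^ n < r) sequentially"
        using r(1) by (intro order_tendstoD(2)) auto
      then obtain N where N: "\<And>n. n \<ge> N \<Longrightarrow> \<theta> * (1 / \<kappa>) ^ n < r"
        by (auto simp: eventually_sequentially)
      \<comment> \<open>As the returns are infinite in number, one of them is late enough for its
        cylinder to have diameter below \<open>r\<close>, hence to stay inside
        \<open>U\<close>.\<close>
      obtain n where n: "n \<ge> max N 1" "(T ^^ n) x \<in> cell k"
        using elim x unfolding INFM_nat_le by blast
      define w where "w = itin x n"
      have w: "x \<in> cyl w" "successively edge w" "w \<noteq> []" "length w - 1 = n"
        using good_itin elim by (auto simp: w_def)
      have "y \<in> ball x r" if "y \<in> cyl w" for y
        using distortion(3)[OF w(3,2), of "{}" x y] w that N[of n] n by (auto simp: dist_real_def)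
      then have "cyl w \<subseteq> U" using r by blast
      moreover have "idx x = k" "idx ((T ^^ n) x) = k" using x Fk n by (auto intro: idx_eq)
      ultimately have "w \<in> H" using w n by (auto simp: H_def G_def w_def)
      then have ex: "\<exists>v. v \<in> H \<and> x \<in> cyl v" using w by blast
      define v where "v = arg_min length (\<lambda>v. v \<in> H \<and> x \<in> cyl v)"
      have v: "v \<in> H" "x \<in> cyl v" using arg_min_natI[of "\<lambda>v. v \<in> H \<and> x \<in> cyl v"] ex by (auto simp: v_def)
      have "take m v \<notin> H" if "m < length v" for m
      proof
        assume "take m v \<in> H"
        moreover have "x \<in> cyl (take m v)" using cyl_take v by blast
        ultimately have "length v \<le> length (take m v)"
          unfolding v_def by (intro arg_min_nat_le) (auto simp: v_def)
        then show False using that by simp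
      qed
      then have "v \<in> H0" using v by (auto simp: H0_def)
      then show "x \<in> (\<Union>w\<in>H0. cyl w)" using v by blast
    qed
  qed
  have cH: "countable H0" by simp
  have bor: "(\<Union>w\<in>H0. cyl w) \<in> sets borel" "(\<Union>w\<in>H0. cyl w - F) \<in> sets borel"
    using cH by (auto intro!: sets.countable_UN')
  have "ennreal (c * measure lborel F) = ennreal c * emeasure lborel F"
    using c by (simp add: mF ennreal_mult)
  also have "\<dots> \<le> ennreal c * emeasure lborel (\<Union>w\<in>H0. cyl w)"
    using cover bor by (intro mult_left_mono emeasure_mono_AE) auto
  also have "\<dots> = ennreal c * (\<integral>\<^sup>+w. emeasure lborel (cyl w) \<partial>count_space H0)"
    using disj by (subst emeasure_UN_countable) auto
  also have "\<dots> = (\<integral>\<^sup>+w. ennreal c * emeasure lborel (cyl w) \<partial>count_space H0)"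
    by (simp add: nn_integral_cmult)
  also have "\<dots> \<le> (\<integral>\<^sup>+w. emeasure lborel (cyl w - F) \<partial>count_space H0)"
  proof (rule nn_integral_mono)
    fix w assume "w \<in> space (count_space H0)"
    then have w: "w \<in> G" "w \<noteq> []" by (auto simp: H0_def H_def G_def)
    have "bounded (cyl w)" using cyl_cell_hd[OF w(2)] cell_bounded bounded_subset by blast
    then have "emeasure lborel (cyl w) = ennreal (measure lborel (cyl w))"
      "emeasure lborel (cyl w - F) = ennreal (measure lborel (cyl w - F))"
      using fin[of "cyl w"] fin[of "cyl w - F"] bounded_subset[of "cyl w" "cyl w - F"]
      by (auto intro!: emeasure_eq_ennreal_measure)
    then show "ennreal c * emeasure lborel (cyl w) \<le> emeasure lborel (cyl w - F)"
      using loss[OF w(1)] c by (simp add: ennreal_mult[symmetric] ennreal_leI)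
  qed
  also have "\<dots> = emeasure lborel (\<Union>w\<in>H0. cyl w - F)"
    using disj by (subst emeasure_UN_countable) (auto simp: disjoint_family_on_def)
  also have "\<dots> \<le> emeasure lborel (U - F)"
    using U by (intro emeasure_mono) (auto simp: H0_def H_def)
  also note UF
  finally show False by simp
qed

text \<open>Only a positive measure of returning points is demanded, so that the negation says that
  almost no point returns infinitely often; full measure is then a theorem.\<close>

definition recurrent :: "int \<Rightarrow> bool" where
  "recurrent k \<longleftrightarrow> \<not> (AE x in lborel. \<not> (x \<in> cell k \<and> (\<exists>\<^sub>\<infinity>n. (T ^^ n) x \<in> cell k)))"

text \<open>The density statement applies with every \<open>\<epsilon>\<close>. The inclusion in
  \<open>B\<close> is required only at return times to \<open>k\<close>, which will allow sets that
  are invariant merely under the power of \<open>T\<close> given by the period.\<close>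

lemma recurrence_spread:
  assumes F: "F \<in> sets borel" "F \<subseteq> cell k" "\<not> (AE x in lborel. x \<notin> F)"
    and ret: "AE x in lborel. x \<in> F \<longrightarrow> (\<exists>\<^sub>\<infinity>n. (T ^^ n) x \<in> cell k)"
    and B [measurable]: "B \<in> sets borel"
    and FB: "\<And>n. n \<ge> 1 \<Longrightarrow> (edge ^^ n) k k \<Longrightarrow> AE x in lborel. x \<in> F \<longrightarrow> (T ^^ n) x \<in> B"
  shows "AE x in lborel. x \<in> cell k \<longrightarrow> x \<in> B"
proof -
  have "measure lborel (cell k - B) \<le> \<epsilon>" if "\<epsilon> > 0" for \<epsilon>
    using recurrence_density[OF F ret that] FB B by blast
  then have "measure lborel (cell k - B) \<le> 0" using field_le_epsilon[of "measure lborel (cell k - B)" 0] by auto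
  moreover have "emeasure lborel (cell k - B) < \<infinity>"
    by (intro emeasure_bounded_finite bounded_subset[OF cell_bounded]) auto
  ultimately have "emeasure lborel (cell k - B) = 0"
    by (metis emeasure_eq_ennreal_measure ennreal_neg infinity_ennreal_def order_less_irrefl)
  then have "AE x in lborel. x \<notin> cell k - B" by (intro AE_not_in) (simp add: null_sets_def)
  then show ?thesis by eventually_elim auto
qed

text \<open>A zero-one law: returning infinitely often is unaffected by shifting the orbit, so the
  set of such points is forward invariant and fills the cell as soon as it meets it in positive
  measure.\<close>

lemma recurrent_AE:
  assumes "recurrent k"
  shows "AE x in lborel. x \<in> cell k \<longrightarrow> (\<exists>\<^sub>\<infinity>n. (T ^^ n) x \<in> cell k)"
proof -
  define B where "B = {x. \<exists>\<^sub>\<infinity>n. (T ^^ n) x \<in> cell k}"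
  have [measurable]: "B \<in> sets borel" unfolding B_def INFM_nat by measurable
  have "AE x in lborel. x \<in> cell k \<longrightarrow> x \<in> B"
  proof (rule recurrence_spread[of "cell k \<inter> B"])
    show "\<not> (AE x in lborel. x \<notin> cell k \<inter> B)" using assms by (simp add: recurrent_def B_def)
    have "(T ^^ n) x \<in> B" if "x \<in> B" for x n
      using that by (simp add: B_def INFM_iterate)
    then show "AE x in lborel. x \<in> cell k \<inter> B \<longrightarrow> (T ^^ n) x \<in> B" for n by auto
  qed (auto simp: B_def[symmetric] intro!: AE_I2, auto simp: B_def)
  then show ?thesis by (simp add: B_def)
qed

text \<open>The points that never enter \<open>A\<close> after time 0 form a forward invariant set.
  If it met the cell in positive measure it would fill it, against \<open>pos\<close>. Applying this
  at each of the infinitely many returns yields infinitely many visits to \<open>A\<close>.\<close>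

lemma recurrent_hits:
  assumes k: "recurrent k" and A [measurable]: "A \<in> sets borel"
    and pos: "\<not> (AE x in lborel. x \<in> cell k \<longrightarrow> (\<forall>n\<ge>1. (T ^^ n) x \<notin> A))"
  shows "AE x in lborel. x \<in> cell k \<longrightarrow> (\<exists>\<^sub>\<infinity>n. (T ^^ n) x \<in> A)"
proof -
  define B where "B = {x. \<forall>n\<ge>1. (T ^^ n) x \<notin> A}"
  have [measurable]: "B \<in> sets borel" unfolding B_def by measurable
  have "AE x in lborel. x \<notin> cell k \<inter> B"
  proof (rule ccontr)
    assume *: "\<not> ?thesis"
    have "(T ^^ n) x \<in> B" if "x \<in> B" for n x
      using that by (auto simp: B_def T_iterate_add)
    then have "AE x in lborel. x \<in> cell k \<longrightarrow> x \<in> B"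
      using recurrent_AE[OF k] by (intro recurrence_spread[OF _ _ *]) auto
    then show False using pos by (simp add: B_def)
  qed
  from AE_T_iterates[OF this] recurrent_AE[OF k] show ?thesis
  proof eventually_elim
    case (elim x)
    show ?case unfolding INFM_nat
    proof (intro impI allI)
      fix m assume "x \<in> cell k"
      then obtain l where l: "l > m" "(T ^^ l) x \<in> cell k" using elim unfolding INFM_nat by blast
      then have "(T ^^ l) x \<notin> B" using elim by blast
      then obtain n where "(T ^^ n) ((T ^^ l) x) \<in> A" by (auto simp: B_def)
      then show "\<exists>n>m. (T ^^ n) x \<in> A" using l by (intro exI[of _ "n + l"]) (simp add: funpow_add)
    qed
  qed
qed

lemma preimage_not_null:
  assumes "(edge ^^ n) k l" "Y \<subseteq> cell l" "\<not> (AE y in lborel. y \<notin> Y)"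
  shows "\<not> (AE x in lborel. x \<in> cell k \<longrightarrow> (T ^^ n) x \<notin> Y)"
proof
  assume "AE x in lborel. x \<in> cell k \<longrightarrow> (T ^^ n) x \<notin> Y"
  from AE_T_iterate_image[OF this, of n] have "AE y in lborel. y \<notin> Y"
    by eventually_elim (use relpowp_onto[OF assms(1)] assms(2) in blast)
  then show False using assms(3) by simp
qed

lemma recurrent_hits_cell:
  assumes k: "recurrent k" and n: "(edge ^^ n) k l" "n \<ge> 1"
    and Y: "Y \<in> sets borel" "Y \<subseteq> cell l" "\<not> (AE y in lborel. y \<notin> Y)"
  shows "AE x in lborel. x \<in> cell k \<longrightarrow> (\<exists>\<^sub>\<infinity>n. (T ^^ n) x \<in> Y)"
proof (rule recurrent_hits[OF k Y(1)], rule notI)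
  assume "AE x in lborel. x \<in> cell k \<longrightarrow> (\<forall>n\<ge>1. (T ^^ n) x \<notin> Y)"
  then have "AE x in lborel. x \<in> cell k \<longrightarrow> (T ^^ n) x \<notin> Y" by eventually_elim (use n in blast)
  then show False using preimage_not_null[OF n(1) Y(2,3)] by simp
qed

text \<open>A set of positive measure in \<open>cell k\<close> passes through \<open>cell l\<close>
  at time \<open>n\<close>, and almost all its points return to \<open>cell k\<close> later; the
  itinerary in between is the required path. So a recurrent state is essential.\<close>

lemma recurrent_feeds_back:
  assumes k: "recurrent k" and n: "(edge ^^ n) k l"
  shows "\<exists>m\<ge>1. (edge ^^ m) l k"
proof (rule ccontr)
  assume none: "\<not> ?thesis"
  from recurrent_AE[OF k] AE_good have "AE x in lborel. x \<in> cell k \<longrightarrow> (T ^^ n) x \<notin> cell l"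
  proof eventually_elim
    case (elim x)
    show ?case
    proof (intro impI notI)
      assume x: "x \<in> cell k" "(T ^^ n) x \<in> cell l"
      obtain m where m: "m > n" "(T ^^ m) x \<in> cell k" using elim x unfolding INFM_nat by blast
      have "(T ^^ (m - n)) ((T ^^ n) x) = (T ^^ m) x"
        using m by (simp add: T_iterate_add)
      then have "(edge ^^ (m - n)) l k"
        using good_relpowp[OF good_iterate, of x "m - n" n] elim x m by (simp add: idx_eq)
      then show False using none m by (metis Suc_leI One_nat_def zero_less_diff)
    qed
  qed
  then show False using preimage_not_null[OF n order_refl cell_not_null] by simp
qed

text \<open>Almost every point of \<open>cell k\<close> visits \<open>cell l\<close> infinitely
  often, and this property is inherited by the images under \<open>T ^^ n\<close>, which cover
  \<open>cell l\<close>.\<close>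

lemma recurrent_feeds:
  assumes k: "recurrent k" and n: "(edge ^^ n) k l"
  shows "recurrent l"
proof -
  obtain m where m: "m \<ge> 1" "(edge ^^ m) l k" using recurrent_feeds_back[OF k n] by blast
  \<comment> \<open>The detour back through \<open>k\<close> makes the path length positive even
    when \<open>n = 0\<close>.\<close>
  then have e: "(edge ^^ (n + m + n)) k l" using relpowp_trans[OF relpowp_trans[OF n m(2)] n] by simp
  have "AE x in lborel. x \<in> cell k \<longrightarrow> (\<exists>\<^sub>\<infinity>n. (T ^^ n) x \<in> cell l)"
    using recurrent_hits_cell[OF k e _ _ order_refl cell_not_null] m by simp
  from AE_T_iterate_image[OF this, of n]
  have "AE y in lborel. y \<in> cell l \<longrightarrow> (\<exists>\<^sub>\<infinity>n. (T ^^ n) y \<in> cell l)"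
  proof eventually_elim
    case (elim y)
    show ?case
    proof
      assume "y \<in> cell l"
      then obtain x where x: "x \<in> cell k" "(T ^^ n) x = y" using relpowp_onto[OF n] by blast
      then have inf: "\<exists>\<^sub>\<infinity>n. (T ^^ n) x \<in> cell l" using elim by blast
      then show "\<exists>\<^sub>\<infinity>n. (T ^^ n) y \<in> cell l" using INFM_iterate[of n x] x(2) by simp
    qed
  qed
  moreover have False if "AE x in lborel. \<not> (x \<in> cell l \<and> (\<exists>\<^sub>\<infinity>n. (T ^^ n) x \<in> cell l))"
  proof -
    have "AE x in lborel. x \<notin> cell l" using calculation that by eventually_elim blast
    then show False using cell_not_null by simp
  qed
  ultimately show ?thesis unfolding recurrent_def by blast
qed

text \<open>Almost every point of the cell, in particular of \<open>W\<close>, would visit the part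
  of \<open>W\<close> in the cell infinitely often. The disjointness is localized to one cell so
  that the lemma serves wandering sets both on the whole line and on the region of a class.\<close>

lemma recurrent_not_wandering:
  assumes k: "recurrent k" and W [measurable]: "W \<in> sets borel"
    and wand: "\<And>n. n \<ge> 1 \<Longrightarrow> AE x in lborel. x \<in> cell k \<longrightarrow> x \<in> W \<longrightarrow> (T ^^ n) x \<notin> W"
  shows "AE x in lborel. x \<in> cell k \<longrightarrow> x \<notin> W"
proof (rule ccontr)
  assume "\<not> ?thesis"
  then have pos: "\<not> (AE x in lborel. x \<notin> W \<inter> cell k)"
    by (rule contrapos_nn) (auto elim: eventually_mono)
  obtain n where n: "n \<ge> 1" "(edge ^^ n) k k" using recurrent_feeds_back[OF k, of 0 k] by auto
  have "AE x in lborel. x \<in> cell k \<longrightarrow> (\<exists>\<^sub>\<infinity>n. (T ^^ n) x \<in> W \<inter> cell k)"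
    using recurrent_hits_cell[OF k n(2,1) _ _ pos] by simp
  moreover have "AE x in lborel. \<forall>n. n \<ge> 1 \<longrightarrow> x \<in> cell k \<longrightarrow> x \<in> W \<longrightarrow> (T ^^ n) x \<notin> W"
    unfolding AE_all_countable using wand by auto
  ultimately have "AE x in lborel. x \<notin> W \<inter> cell k"
  proof eventually_elim
    case (elim x)
    then show ?case unfolding INFM_nat by (metis IntD1 IntD2 Suc_leI One_nat_def)
  qed
  then show False using pos by simp
qed

section \<open>The dissipative part in terms of states\<close>

lemma dissipative_part: "is_measurable_union {W. wandering UNIV T W} (dissipative_part T)"
  unfolding dissipative_part_def
  by (rule someI_ex, rule measurable_union_exists) (auto simp: wandering_def)

lemma recurrent_conservative:
  assumes "recurrent k"
  shows "AE x in lborel. x \<in> cell k \<longrightarrow> x \<notin> dissipative_part T"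
proof -
  have "ae_subset W (- cell k)" if W: "wandering UNIV T W" for W
  proof -
    have "AE x in lborel. x \<in> cell k \<longrightarrow> x \<notin> W"
    proof (rule recurrent_not_wandering[OF assms])
      fix n :: nat assume "n \<ge> 1"
      then have "ae_disjoint ((T ^^ n) -` W \<inter> UNIV) ((T ^^ 0) -` W \<inter> UNIV)"
        using W unfolding wandering_def by (metis not_one_le_zero)
      then show "AE x in lborel. x \<in> cell k \<longrightarrow> x \<in> W \<longrightarrow> (T ^^ n) x \<notin> W"
        unfolding ae_disjoint_def by eventually_elim auto
    qed (use W in \<open>auto simp: wandering_def\<close>)
    then show ?thesis unfolding ae_subset_def by eventually_elim auto
  qed
  then have "ae_subset (dissipative_part T) (- cell k)"
    using dissipative_part unfolding is_measurable_union_def by auto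
  then show ?thesis unfolding ae_subset_def by eventually_elim auto
qed

lemma transient_dissipative:
  assumes "\<not> recurrent k"
  shows "AE x in lborel. x \<in> cell k \<longrightarrow> x \<in> dissipative_part T"
proof -
  \<comment> \<open>\<open>W n\<close> collects the points whose last visit to \<open>cell k\<close>
    takes place at time \<open>n\<close>. A point with \<open>T ^^ i\<close> image in
    \<open>W n\<close> has last visit time \<open>i + n\<close>, so different \<open>i\<close>
    exclude each other.\<close>
  define W where "W n = {x. (T ^^ n) x \<in> cell k \<and> (\<forall>m\<ge>1. (T ^^ m) ((T ^^ n) x) \<notin> cell k)}" for n
  have W: "W n \<in> sets borel" for n
    unfolding W_def by measurable
  have "wandering UNIV T (W n)" for n
    unfolding wandering_def
  proof (intro conjI allI impI)
    fix i j :: nat assume "i \<noteq> j"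
    have *: "\<not> ((T ^^ i) x \<in> W n \<and> (T ^^ j) x \<in> W n)" if "i < j" for i j x
    proof
      assume x: "(T ^^ i) x \<in> W n \<and> (T ^^ j) x \<in> W n"
      have "(T ^^ (j - i)) ((T ^^ n) ((T ^^ i) x)) = (T ^^ n) ((T ^^ j) x)"
        using that by (simp add: T_iterate_add add.commute)
      then have "(T ^^ n) ((T ^^ j) x) \<notin> cell k" using x that unfolding W_def
        by (metis (mono_tags, lifting) One_nat_def Suc_leI mem_Collect_eq zero_less_diff)
      then show False using x by (simp add: W_def)
    qed
    have "\<not> ((T ^^ i) x \<in> W n \<and> (T ^^ j) x \<in> W n)" for x
      using *[of i j x] *[of j i x] \<open>i \<noteq> j\<close> by (cases "i < j") auto
    then show "ae_disjoint ((T ^^ i) -` W n \<inter> UNIV) ((T ^^ j) -` W n \<inter> UNIV)"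
      by (simp add: ae_disjoint_def)
  qed (auto simp: W ae_subset_def)
  then have "ae_subset (W n) (dissipative_part T)" for n
    using dissipative_part unfolding is_measurable_union_def by auto
  then have "AE x in lborel. \<forall>n. x \<in> W n \<longrightarrow> x \<in> dissipative_part T"
    unfolding AE_all_countable ae_subset_def by blast
  moreover have "AE x in lborel. \<not> (x \<in> cell k \<and> (\<exists>\<^sub>\<infinity>n. (T ^^ n) x \<in> cell k))"
    using assms by (simp add: recurrent_def)
  ultimately show ?thesis
  proof eventually_elim
    case (elim x)
    show ?case
    proof
      assume x: "x \<in> cell k"
      define A where "A = {n. (T ^^ n) x \<in> cell k}"
      have A: "finite A" "0 \<in> A" using elim x by (auto simp: A_def INFM_iff_infinite)
      then have "Max A \<in> A" by (metis Max_in empty_iff)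
      moreover have "m + Max A \<notin> A" if "m \<ge> 1" for m
        using that A Max_ge[OF A(1), of "m + Max A"] by auto
      ultimately have "x \<in> W (Max A)" by (auto simp: W_def A_def funpow_add)
      then show "x \<in> dissipative_part T" using elim by blast
    qed
  qed
qed

text \<open>Modulo null sets the dissipative part is a union of cells; from here on it enters only
  through the recurrence of states.\<close>

lemma AE_dissipative_iff: "AE x in lborel. good x \<and> (x \<in> dissipative_part T \<longleftrightarrow> \<not> recurrent (idx x))"
proof -
  have "AE x in lborel. \<forall>k. x \<in> cell k \<longrightarrow> (x \<in> dissipative_part T \<longleftrightarrow> \<not> recurrent k)"
    unfolding AE_all_countable
  proof
    show "AE x in lborel. x \<in> cell k \<longrightarrow> (x \<in> dissipative_part T \<longleftrightarrow> \<not> recurrent k)" for k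
      using recurrent_conservative[of k] transient_dissipative[of k]
      by (cases "recurrent k") simp_all
  qed
  with AE_good show ?thesis by eventually_elim (use good_cell in blast)
qed

subsection \<open>Communicating classes and their periods\<close>

lemma feeds_iff: "feeds a T j k \<longleftrightarrow> (\<exists>n\<ge>1. (edge ^^ n) j k)"
  by (simp add: feeds_def ae_subset_markov_image_iff)

lemma feeds_trans: "feeds a T i j \<Longrightarrow> feeds a T j k \<Longrightarrow> feeds a T i k"
  unfolding feeds_iff by (meson relpowp_trans trans_le_add1)

lemma edge_feeds: "edge i j \<Longrightarrow> feeds a T i j"
  unfolding feeds_iff by (intro exI[of _ 1]) auto

lemma edge_exists: "\<exists>j. edge i j"
proof -
  have "\<exists>x. x \<in> cell i \<and> good x"
  proof (rule ccontr)
    assume none: "\<not> ?thesis"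
    from AE_good have "AE x in lborel. x \<notin> cell i" by eventually_elim (use none in blast)
    then show False using cell_not_null by simp
  qed
  then obtain x where x: "x \<in> cell i" "good x" by blast
  then have "T x \<in> cell (idx (T x))" using good_cell good_T by blast
  then show ?thesis unfolding edge_def using x by blast
qed

text \<open>Asking for \<open>n \<ge> 1\<close> also when \<open>i = j\<close> gives every state a
  loop, even in a class with one element, so the period is positive.\<close>

definition closed_class :: "int set \<Rightarrow> bool" where
  "closed_class Z \<longleftrightarrow> Z \<noteq> {} \<and> (\<forall>i\<in>Z. \<forall>j. edge i j \<longrightarrow> j \<in> Z) \<and> (\<forall>i\<in>Z. \<forall>j\<in>Z. \<exists>n\<ge>1. (edge ^^ n) i j)"

lemma closed_class_relpowp: "closed_class Z \<Longrightarrow> i \<in> Z \<Longrightarrow> (edge ^^ n) i j \<Longrightarrow> j \<in> Z"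
proof (induction n arbitrary: j)
  case (Suc n)
  from \<open>(edge ^^ Suc n) i j\<close> obtain l where "(edge ^^ n) i l" "edge l j" by (rule relpowp_Suc_E)
  with Suc show ?case unfolding closed_class_def by blast
qed simp

lemma equiv_communicate: "equiv UNIV {(j, k). communicate a T j k}"
  by (rule equivI) (auto simp: refl_on_def sym_def trans_def communicate_def intro: feeds_trans)

lemma essential_closed_class:
  assumes Z: "Z \<in> comm_classes a T" and ess: "\<forall>j\<in>Z. \<not> inessential a T j"
  shows "closed_class Z"
proof -
  note eq = equiv_communicate
  have Z': "Z \<in> UNIV // {(j, k). communicate a T j k}" using Z by (simp add: comm_classes_def)
  have cl: "k \<in> Z" if "j \<in> Z" "feeds a T j k" for j k
  proof -
    have "feeds a T k j" using ess that by (auto simp: inessential_def)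
    then have "(j, k) \<in> {(j, k). communicate a T j k}" using that by (simp add: communicate_def)
    then show ?thesis using in_quotient_imp_closed[OF eq Z'] that by blast
  qed
  \<comment> \<open>A state communicates with itself by convention, so a genuine loop has to be
    produced: leave along any edge and return because the state is essential.\<close>
  have self: "feeds a T i i" if i: "i \<in> Z" for i
  proof -
    obtain k where "edge i k" using edge_exists by blast
    then have "feeds a T i k" by (rule edge_feeds)
    moreover then have "feeds a T k i" using ess i by (auto simp: inessential_def)
    ultimately show ?thesis by (rule feeds_trans)
  qed
  have "\<exists>n\<ge>1. (edge ^^ n) i j" if "i \<in> Z" "j \<in> Z" for i j
  proof -
    have "communicate a T i j" using quotient_eq_iff[OF eq Z' Z' that] by simp
    then have "feeds a T i j" using self that by (auto simp: communicate_def)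
    then show ?thesis by (simp add: feeds_iff)
  qed
  moreover have "Z \<noteq> {}" using in_quotient_imp_non_empty[OF eq Z'] .
  ultimately show ?thesis using cl edge_feeds unfolding closed_class_def by blast
qed

lemma terminal_closed_class: "Z \<in> terminal_classes a T \<Longrightarrow> closed_class Z"
  by (auto simp: terminal_classes_def intro: essential_closed_class)

lemma state_period_eq: "state_period a T j = Gcd {n. n \<ge> 1 \<and> (edge ^^ n) j j}"
  by (simp add: state_period_def ae_subset_markov_image_iff)

text \<open>Inserting a loop at \<open>i\<close> into a fixed loop at \<open>j\<close> through
  \<open>i\<close> changes the length by that of the inserted loop, so the period of
  \<open>j\<close> divides the period of \<open>i\<close>. By symmetry all periods agree, which
  determines the \<open>THE\<close> in the definition.\<close>

lemma class_period_eq: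
  assumes Z: "closed_class Z" and k: "k \<in> Z"
  shows "class_period a T Z = Gcd {n. n \<ge> 1 \<and> (edge ^^ n) k k}"
proof -
  have dvd: "state_period a T j dvd state_period a T i" if ij: "i \<in> Z" "j \<in> Z" for i j
    unfolding state_period_eq[of i]
  proof (rule Gcd_greatest)
    fix n assume n: "n \<in> {n. n \<ge> 1 \<and> (edge ^^ n) i i}"
    obtain r s where r: "r \<ge> 1" "(edge ^^ r) j i" and s: "s \<ge> 1" "(edge ^^ s) i j"
      using Z ij unfolding closed_class_def by meson
    have "state_period a T j dvd r + s" "state_period a T j dvd r + n + s"
      unfolding state_period_eq using n r s by (auto intro!: Gcd_dvd intro: relpowp_trans)
    moreover have "r + n + s = n + (r + s)" by simp
    ultimately show "state_period a T j dvd n" by (metis dvd_add_left_iff)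
  qed
  have "class_period a T Z = state_period a T k"
    unfolding class_period_def using dvd k by (intro the_equality) (auto intro: dvd_antisym)
  then show ?thesis by (simp add: state_period_eq)
qed

text \<open>The third part is aperiodicity of \<open>T ^^ d\<close> on the class in the form needed
  for exactness: two loops at \<open>k\<close> whose lengths differ by a single step of
  \<open>T ^^ d\<close>.\<close>

lemma class_period_facts:
  assumes Z: "closed_class Z" and k: "k \<in> Z"
  shows "0 < class_period a T Z"
    and "(edge ^^ n) k k \<Longrightarrow> class_period a T Z dvd n"
    and "\<exists>p. (edge ^^ (class_period a T Z * p)) k k \<and> (edge ^^ (class_period a T Z * Suc p)) k k"
proof -
  define R where "R = {n. n \<ge> 1 \<and> (edge ^^ n) k k}"
  have d: "class_period a T Z = Gcd R" using class_period_eq[OF assms] by (simp add: R_def)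
  have ne: "R \<noteq> {}" using Z k by (auto simp: R_def closed_class_def)
  show dvd: "class_period a T Z dvd n" if "(edge ^^ n) k k" for n
    using that unfolding d by (cases "n = 0") (auto simp: R_def intro!: Gcd_dvd)
  show "0 < class_period a T Z"
    using ne dvd by (auto simp: R_def) (metis One_nat_def dvd_0_left_iff gr0I not_one_le_zero)
  have "\<exists>p. Gcd R * p \<in> R \<and> Gcd R * Suc p \<in> R"
    using ne by (intro Gcd_additive_consecutive) (auto simp: R_def intro: relpowp_trans)
  then show "\<exists>p. (edge ^^ (class_period a T Z * p)) k k \<and> (edge ^^ (class_period a T Z * Suc p)) k k"
    by (auto simp: d) (auto simp: R_def)
qed

text \<open>The cyclic decomposition of a strongly connected graph: the phase of \<open>j\<close> is
  the length modulo \<open>d\<close> of a path from a base state \<open>k\<close>. It does not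
  depend on the path, since two paths closed up by the same return have lengths divisible by
  \<open>d\<close>.\<close>

lemma phase_exists:
  assumes Z: "closed_class Z"
  defines "d \<equiv> class_period a T Z"
  obtains ph :: "int \<Rightarrow> nat" where
    "\<And>i. ph i < d"
    "\<And>i j n. i \<in> Z \<Longrightarrow> (edge ^^ n) i j \<Longrightarrow> ph j = (ph i + n) mod d"
    "\<And>i j. i \<in> Z \<Longrightarrow> j \<in> Z \<Longrightarrow> ph i = ph j \<Longrightarrow> \<exists>n. (edge ^^ (d * n)) i j"
    "\<And>r. r < d \<Longrightarrow> \<exists>j\<in>Z. ph j = r"
    "\<And>j. j \<in> Z \<Longrightarrow> \<exists>i\<in>Z. edge i j"
proof -
  obtain k where k: "k \<in> Z" using Z by (auto simp: closed_class_def)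
  have d: "0 < d" unfolding d_def by (rule class_period_facts(1)[OF Z k])
  have conn: "\<exists>n. (edge ^^ n) i j" if "i \<in> Z" "j \<in> Z" for i j
    using Z that unfolding closed_class_def by meson
  have cong: "m mod d = n mod d" if mn: "(edge ^^ m) k j" "(edge ^^ n) k j" and j: "j \<in> Z" for m n j
  proof -
    obtain r where r: "(edge ^^ r) j k" using conn[OF j k] by blast
    have "d dvd m + r" "d dvd n + r"
      unfolding d_def using class_period_facts(2)[OF Z k] relpowp_trans[OF _ r] mn by blast+
    then have "[m + r = n + r] (mod d)" by (simp add: cong_def)
    then have "[m = n] (mod d)" by (simp add: cong_add_rcancel_nat)
    then show ?thesis by (simp add: cong_def)
  qed
  define N where "N j = (SOME n. (edge ^^ n) k j)" for j
  have N: "(edge ^^ N j) k j" if "j \<in> Z" for j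
    unfolding N_def using conn[OF k that] by (rule someI_ex)
  define ph where "ph j = N j mod d" for j
  have ph_lt: "ph j < d" for j using d by (simp add: ph_def)
  have ph_step: "ph j = (ph i + n) mod d" if i: "i \<in> Z" and ij: "(edge ^^ n) i j" for i j n
  proof -
    have j: "j \<in> Z" using closed_class_relpowp[OF Z i ij] .
    have "N j mod d = (N i + n) mod d"
      using cong[OF N[OF j] relpowp_trans[OF N[OF i] ij] j] .
    then show ?thesis by (simp add: ph_def mod_add_left_eq)
  qed
  have ph_conn: "\<exists>n. (edge ^^ (d * n)) i j" if ij: "i \<in> Z" "j \<in> Z" "ph i = ph j" for i j
  proof -
    obtain n where n: "(edge ^^ n) i j" using conn ij by blast
    have "(ph i + n) mod d = ph i mod d" using ph_step[OF ij(1) n] ij(3) ph_lt by simp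
    then have "d dvd n" by (metis add_diff_cancel_left' le_add1 mod_eq_dvd_iff_nat)
    then show ?thesis using n by auto
  qed
  have reach: "\<exists>j. (edge ^^ n) k j" for n
  proof (induction n)
    case (Suc n)
    then obtain j where "(edge ^^ n) k j" by blast
    moreover obtain l where "edge j l" using edge_exists by blast
    ultimately have "(edge ^^ Suc n) k l" by (rule relpowp_Suc_I)
    then show ?case by blast
  qed (auto intro: exI[of _ k])
  have ph_surj: "\<exists>j\<in>Z. ph j = r" if r: "r < d" for r
  proof -
    \<comment> \<open>A path of this length first cancels the phase of \<open>k\<close> modulo
      \<open>d\<close> and then adds \<open>r\<close>.\<close>
    obtain j where j: "(edge ^^ (r + (d - ph k))) k j" using reach by blast
    have "ph k + (r + (d - ph k)) = r + d" using ph_lt[of k] by simp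
    then have "ph j = r" using ph_step[OF k j] r by simp
    then show ?thesis using closed_class_relpowp[OF Z k j] by blast
  qed
  have pred: "\<exists>i\<in>Z. edge i j" if j: "j \<in> Z" for j
  proof -
    obtain n where n: "n \<ge> 1" "(edge ^^ n) j j" using Z j unfolding closed_class_def by blast
    then obtain m where m: "n = Suc m" by (cases n) auto
    obtain i where "(edge ^^ m) j i" "edge i j" using n(2) unfolding m by (auto elim: relpowp_Suc_E)
    then show ?thesis using closed_class_relpowp[OF Z j] by blast
  qed
  show ?thesis by (rule that[of ph]) (use ph_lt ph_step ph_conn ph_surj pred in auto)
qed

section \<open>Regions and basins of classes\<close>

lemma good_region_iff: "good x \<Longrightarrow> x \<in> class_region a Z \<longleftrightarrow> idx x \<in> Z"
proof -
  assume x: "good x"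
  then have "x \<notin> range a" unfolding good_def by (metis funpow_0)
  then have "x \<in> markov_interval a j \<longleftrightarrow> idx x = j" for j
    using markov_interval_diff_cell cell_subset_markov good_cell_iff[OF x] by blast
  then show ?thesis by (auto simp: class_region_def)
qed

lemma good_basin_iff: "good x \<Longrightarrow> x \<in> class_basin a T Z \<longleftrightarrow> (\<exists>n. idx ((T ^^ n) x) \<in> Z)"
  by (simp add: class_basin_def good_region_iff good_iterate)

lemma class_region_borel [measurable]: "class_region a Z \<in> sets borel"
  by (auto simp: class_region_def markov_interval_def intro!: sets.countable_UN')

lemma class_basin_borel [measurable]: "class_basin a T Z \<in> sets borel"
proof -
  have "(T ^^ n) -` class_region a Z \<in> sets borel" for n
    using measurable_sets[OF T_iterate_measurable class_region_borel] by simp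
  then show ?thesis unfolding class_basin_def by auto
qed

section \<open>Filling of classes by invariant sets: ergodicity and exactness\<close>

lemma not_null_cell:
  assumes "\<not> (AE x in lborel. x \<notin> F)"
  obtains k where "\<not> (AE x in lborel. x \<notin> F \<inter> cell k)"
proof -
  have "\<exists>k. \<not> (AE x in lborel. x \<notin> F \<inter> cell k)"
  proof (rule ccontr)
    assume "\<not> ?thesis"
    then have "AE x in lborel. \<forall>k. x \<notin> F \<inter> cell k" unfolding AE_all_countable by blast
    with AE_good have "AE x in lborel. x \<notin> F" by eventually_elim (use good_cell in blast)
    then show False using assms by simp
  qed
  then show ?thesis using that by blast
qed

lemma not_null_cell_region:
  assumes pos: "\<not> (AE x in lborel. x \<notin> F)" and sub: "ae_subset F (class_region a Z)"
  obtains k where "k \<in> Z" "\<not> (AE x in lborel. x \<notin> F \<inter> cell k)"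
proof -
  obtain k where k: "\<not> (AE x in lborel. x \<notin> F \<inter> cell k)" using not_null_cell[OF pos] .
  moreover have "k \<in> Z"
  proof (rule ccontr)
    assume nk: "k \<notin> Z"
    from sub[unfolded ae_subset_def] AE_good have "AE x in lborel. x \<notin> F \<inter> cell k"
      by eventually_elim (use nk in \<open>auto simp: good_region_iff idx_eq\<close>)
    then show False using k by simp
  qed
  ultimately show ?thesis using that by blast
qed

text \<open>Used with \<open>s = 1\<close> for ergodicity and with \<open>s\<close> the period for
  the cyclic pieces. As \<open>s\<close> divides every return time, invariance under
  \<open>T ^^ s\<close> covers all returns and \<open>B\<close> fills \<open>cell k\<close>; its
  images along a path of length \<open>s * q\<close> then cover \<open>cell l\<close>.\<close>

lemma invariant_spread:
  assumes k: "recurrent k" and B [measurable]: "B \<in> sets borel"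
    and inv: "AE x in lborel. x \<in> B \<longrightarrow> (T ^^ s) x \<in> B"
    and per: "\<And>n. (edge ^^ n) k k \<Longrightarrow> s dvd n"
    and pos: "\<not> (AE x in lborel. x \<notin> B \<inter> cell k)"
    and q: "(edge ^^ (s * q)) k l"
  shows "AE x in lborel. x \<in> cell l \<longrightarrow> x \<in> B"
proof -
  have inv': "AE x in lborel. x \<in> B \<longrightarrow> (T ^^ (s * q)) x \<in> B" for q
  proof (induction q)
    case (Suc q)
    from Suc AE_T_iterate[OF inv, of "s * q"] show ?case
      by eventually_elim (simp add: T_iterate_add)
  qed simp
  have "AE x in lborel. x \<in> cell k \<longrightarrow> x \<in> B"
  proof (rule recurrence_spread[OF _ _ pos _ B])
    show "AE x in lborel. x \<in> B \<inter> cell k \<longrightarrow> (\<exists>\<^sub>\<infinity>n. (T ^^ n) x \<in> cell k)"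
      using recurrent_AE[OF k] by eventually_elim auto
    fix n assume "(edge ^^ n) k k"
    then obtain q where q: "n = s * q" using per by blast
    show "AE x in lborel. x \<in> B \<inter> cell k \<longrightarrow> (T ^^ n) x \<in> B"
      using inv'[of q] unfolding q by eventually_elim auto
  qed auto
  then have "AE x in lborel. x \<in> cell k \<longrightarrow> (T ^^ (s * q)) x \<in> B"
    using inv'[of q] by eventually_elim auto
  from AE_T_iterate_image[OF this, of "s * q"] show ?thesis
    by eventually_elim (use relpowp_onto[OF q] in blast)
qed

text \<open>If \<open>B\<close> is in the tail but not invariant under \<open>T ^^ d\<close>, some cell is almost filled by the points
  whose \<open>p\<close>-th image under \<open>T ^^ d\<close> lies in a tail set \<open>C\<close> while their \<open>(p + 1)\<close>-st image does not. As
  the cell covers itself after both \<open>p\<close> and \<open>p + 1\<close> steps, both \<open>C\<close> and its complement would almost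
  fill the cell.\<close>

lemma tail_invariant:
  assumes Z: "closed_class Z" and rec: "\<And>k. k \<in> Z \<Longrightarrow> recurrent k"
    and B [measurable]: "B \<in> sets borel" and BP: "ae_subset B P" and PM: "ae_subset P (class_region a Z)"
    and PT: "AE x in lborel. x \<in> P \<longrightarrow> (T ^^ class_period a T Z) x \<in> P"
    and C: "\<And>n. C n \<in> sets borel"
      "\<And>n. ae_eq B ((T ^^ (class_period a T Z * n)) -` C n \<inter> P)"
  shows "AE x in lborel. x \<in> B \<longrightarrow> (T ^^ class_period a T Z) x \<in> B"
proof (rule ccontr)
  define d where "d = class_period a T Z"
  define F where "F = B - (T ^^ d) -` B"
  have F [measurable]: "F \<in> sets borel"
    using measurable_sets[OF T_iterate_measurable B, of d] by (simp add: F_def)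
  assume "\<not> ?thesis"
  then have "\<not> (AE x in lborel. x \<notin> F)" by (simp add: F_def d_def)
  moreover have "ae_subset F (class_region a Z)"
    using BP PM unfolding ae_subset_def by eventually_elim (auto simp: F_def)
  ultimately obtain k where k: "k \<in> Z" and pos: "\<not> (AE x in lborel. x \<notin> F \<inter> cell k)"
    by (rule not_null_cell_region)
  \<comment> \<open>Points of \<open>F\<close> lie in \<open>B\<close>, while their images under
    \<open>T ^^ d\<close> lie in \<open>P\<close> but not in \<open>B\<close>. Reading both facts
    through the representation of \<open>B\<close> at level \<open>q\<close> gives the two
    memberships, one step of \<open>T ^^ d\<close> apart.\<close>
  have tail: "AE x in lborel. x \<in> F \<longrightarrow> (T ^^ (d * q)) x \<in> C q \<and> (T ^^ (d * Suc q)) x \<notin> C q" for q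
    using C(2)[of q] AE_T_iterate[OF C(2)[of q, unfolded ae_eq_def], of d] BP PT
    unfolding ae_eq_def ae_subset_def d_def[symmetric]
    by eventually_elim (auto simp: F_def T_iterate_add add.commute)
  obtain p where p: "(edge ^^ (d * p)) k k" "(edge ^^ (d * Suc p)) k k"
    using class_period_facts(3)[OF Z k] unfolding d_def by blast
  define m where "m = measure lborel (cell k)"
  have m: "0 < m" unfolding m_def by (rule measure_cell_pos)
  \<comment> \<open>A single returning cylinder along the path already gives the comparison, with a
    constant that depends on \<open>n\<close> but not on \<open>X\<close> and
    \<open>Y\<close>.\<close>
  have "\<exists>\<mu>>0. \<forall>Y\<in>sets borel. \<forall>X\<in>sets borel. X \<subseteq> cell k \<longrightarrow> Y \<subseteq> cell k \<longrightarrow>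
      (\<forall>x\<in>cell k. (T ^^ n) x \<in> Y \<longrightarrow> x \<in> X) \<longrightarrow> measure lborel Y \<le> \<mu> * measure lborel X"
    if n: "(edge ^^ n) k k" for n
  proof -
    obtain w where w: "length w = Suc n" "hd w = k" "last w = k" "successively edge w"
      using n unfolding relpowp_edge_word by blast
    then have w': "w \<noteq> []" "length w - 1 = n" by auto
    have c: "0 < measure lborel (cyl w)" using distortion(2)[OF w'(1) w(4), of "{}"] by simp
    have "measure lborel Y \<le> dconst\<^sup>2 * m / measure lborel (cyl w) * measure lborel X"
      if XY: "Y \<in> sets borel" "X \<in> sets borel" "X \<subseteq> cell k" "Y \<subseteq> cell k"
        and sub: "\<forall>x\<in>cell k. (T ^^ n) x \<in> Y \<longrightarrow> x \<in> X" for X Y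
    proof -
      have bX: "bounded X" using XY(3) cell_bounded bounded_subset by blast
      have s: "cyl w \<inter> (T ^^ n) -` Y \<subseteq> X" using sub cyl_cell_hd[OF w'(1)] w(2) by blast
      have "measure lborel (cyl w \<inter> (T ^^ n) -` Y) \<le> measure lborel X"
      proof (rule measure_mono_fmeasurable[OF s])
        show "cyl w \<inter> (T ^^ n) -` Y \<in> sets lborel"
          using measurable_sets[OF T_iterate_measurable XY(1), of n] by simp
        show "X \<in> fmeasurable lborel"
          using XY(2) emeasure_bounded_finite[OF bX] by (simp add: fmeasurable_def)
      qed
      then have "dconst\<^sup>2 * m * measure lborel (cyl w \<inter> (T ^^ n) -` Y) \<le> dconst\<^sup>2 * m * measure lborel X"
        using m by (intro mult_left_mono) auto
      then have "measure lborel (cyl w) * measure lborel Y \<le> dconst\<^sup>2 * m * measure lborel X"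
        using distortion(1)[OF w'(1) w(4) XY(1)] XY(4) w w'(2) by (simp add: m_def)
      then show ?thesis using pos_le_divide_eq[OF c] by (simp add: mult.commute)
    qed
    moreover have "0 < dconst\<^sup>2 * m / measure lborel (cyl w)"
      using m c by (intro divide_pos_pos mult_pos_pos zero_less_power dconst_pos)
    ultimately show ?thesis by blast
  qed
  note absc = this
  obtain \<mu>1 where \<mu>1: "\<mu>1 > 0" "\<forall>Y\<in>sets borel. \<forall>X\<in>sets borel. X \<subseteq> cell k \<longrightarrow> Y \<subseteq> cell k \<longrightarrow>
      (\<forall>x\<in>cell k. (T ^^ (d * p)) x \<in> Y \<longrightarrow> x \<in> X) \<longrightarrow> measure lborel Y \<le> \<mu>1 * measure lborel X"
    using absc[OF p(1)] by blast
  obtain \<mu>2 where \<mu>2: "\<mu>2 > 0" "\<forall>Y\<in>sets borel. \<forall>X\<in>sets borel. X \<subseteq> cell k \<longrightarrow> Y \<subseteq> cell k \<longrightarrow>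
      (\<forall>x\<in>cell k. (T ^^ (d * Suc p)) x \<in> Y \<longrightarrow> x \<in> X) \<longrightarrow> measure lborel Y \<le> \<mu>2 * measure lborel X"
    using absc[OF p(2)] by blast
  \<comment> \<open>Chosen so that \<open>(\<mu>1 + \<mu>2) * \<epsilon>\<close> is
    \<open>m / 2\<close>, whereas \<open>D\<close> and its complement share the full measure
    \<open>m\<close> of the cell.\<close>
  define \<epsilon> where "\<epsilon> = m / (2 * (\<mu>1 + \<mu>2))"
  have \<epsilon>: "0 < \<epsilon>" using m \<mu>1 \<mu>2 by (simp add: \<epsilon>_def)
  have ret: "AE x in lborel. x \<in> F \<inter> cell k \<longrightarrow> (\<exists>\<^sub>\<infinity>n. (T ^^ n) x \<in> cell k)"
    using recurrent_AE[OF rec[OF k]] by eventually_elim auto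
  have Fk: "F \<inter> cell k \<in> sets borel" "F \<inter> cell k \<subseteq> cell k" by auto
  obtain n where n: "n \<ge> 1" "(edge ^^ n) k k" and small:
      "\<forall>X\<in>sets borel. (AE x in lborel. x \<in> F \<inter> cell k \<longrightarrow> (T ^^ n) x \<in> X) \<longrightarrow> measure lborel (cell k - X) \<le> \<epsilon>"
    using recurrence_density[OF Fk pos ret \<epsilon>] by blast
  obtain q where q: "n = d * q" using class_period_facts(2)[OF Z k n(2)] unfolding d_def by blast
  \<comment> \<open>After the return at time \<open>d * q\<close>, the next \<open>p\<close> steps
    of \<open>T ^^ d\<close> lead to level \<open>q + p\<close>; a point in \<open>F\<close> is in
    \<open>D\<close> at that moment and outside it one step later.\<close>
  define D where "D = C (q + p)"
  have [measurable]: "D \<in> sets borel" by (simp add: D_def C)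
  define X where "X = {y. (T ^^ (d * p)) y \<in> D \<and> (T ^^ (d * Suc p)) y \<notin> D}"
  have [measurable]: "X \<in> sets borel" unfolding X_def by measurable
  have "AE x in lborel. x \<in> F \<inter> cell k \<longrightarrow> (T ^^ n) x \<in> X"
    using tail[of "q + p"] by eventually_elim (auto simp: X_def D_def q T_iterate_add algebra_simps)
  then have X\<epsilon>: "measure lborel (cell k - X) \<le> \<epsilon>" using small by auto
  have "measure lborel (cell k - D) \<le> \<mu>1 * measure lborel (cell k - X)"
    by (rule \<mu>1(2)[rule_format]) (auto simp: X_def)
  moreover have "measure lborel (cell k \<inter> D) \<le> \<mu>2 * measure lborel (cell k - X)"
    by (rule \<mu>2(2)[rule_format]) (auto simp: X_def)
  moreover have "m = measure lborel (cell k - D) + measure lborel (cell k \<inter> D)"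
  proof -
    have "m = measure lborel ((cell k - D) \<union> (cell k \<inter> D))" unfolding m_def by (rule arg_cong[of _ _ "measure lborel"]) auto
    also have "\<dots> = measure lborel (cell k - D) + measure lborel (cell k \<inter> D)"
    proof (rule measure_Un2[THEN trans])
      have fm: "X' \<in> fmeasurable lborel" if "X' \<in> sets borel" "X' \<subseteq> cell k" for X'
        using that emeasure_bounded_finite[OF bounded_subset[OF cell_bounded that(2)]] by (simp add: fmeasurable_def)
      show "cell k - D \<in> fmeasurable lborel" "cell k \<inter> D \<in> fmeasurable lborel"
        by (rule fm; simp)+
      have "(cell k \<inter> D) - (cell k - D) = cell k \<inter> D" by auto
      then show "measure lborel (cell k - D) + measure lborel (cell k \<inter> D - (cell k - D)) =
          measure lborel (cell k - D) + measure lborel (cell k \<inter> D)" by simp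
    qed
    finally show ?thesis .
  qed
  ultimately have "m \<le> (\<mu>1 + \<mu>2) * measure lborel (cell k - X)" by (simp add: algebra_simps)
  also have "\<dots> \<le> (\<mu>1 + \<mu>2) * \<epsilon>" using X\<epsilon> \<mu>1 \<mu>2 by (intro mult_left_mono) auto
  also have "\<dots> = m / 2" using \<mu>1 \<mu>2 by (simp add: \<epsilon>_def divide_simps)
  finally show False using m by simp
qed

lemma closed_class_orbit: "closed_class Z \<Longrightarrow> good x \<Longrightarrow> idx x \<in> Z \<Longrightarrow> idx ((T ^^ n) x) \<in> Z"
  using closed_class_relpowp good_relpowp by blast

lemma closed_class_recurrent: "closed_class Z \<Longrightarrow> k \<in> Z \<Longrightarrow> recurrent k \<Longrightarrow> l \<in> Z \<Longrightarrow> recurrent l"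
  unfolding closed_class_def using recurrent_feeds by blast

lemma region_not_null: "k \<in> Z \<Longrightarrow> \<not> (AE x in lborel. x \<notin> class_region a Z)"
proof
  assume k: "k \<in> Z" and "AE x in lborel. x \<notin> class_region a Z"
  then have "AE x in lborel. x \<notin> cell k"
    using cell_subset_markov[of k] by (auto simp: class_region_def elim!: eventually_mono)
  then show False using cell_not_null by simp
qed

text \<open>The state set \<open>Y\<close> is kept separate from a class because it will be either a
  whole class, with \<open>s = 1\<close>, or the states of one phase, with \<open>s\<close> the
  period.\<close>

lemma region_fill:
  assumes rec: "\<And>k. k \<in> Y \<Longrightarrow> recurrent k" and B: "B \<in> sets borel" "ae_subset B (class_region a Y)"
    and pos: "emeasure lborel B \<noteq> 0" and inv: "AE x in lborel. x \<in> B \<longrightarrow> (T ^^ s) x \<in> B"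
    and per: "\<And>k n. k \<in> Y \<Longrightarrow> (edge ^^ n) k k \<Longrightarrow> s dvd n"
    and conn: "\<And>k l. k \<in> Y \<Longrightarrow> l \<in> Y \<Longrightarrow> \<exists>q. (edge ^^ (s * q)) k l"
  shows "ae_eq B (class_region a Y)"
proof -
  have "\<not> (AE x in lborel. x \<notin> B)" using pos B by (simp add: emeasure_lborel_eq_0_iff)
  then obtain k where k: "k \<in> Y" "\<not> (AE x in lborel. x \<notin> B \<inter> cell k)"
    using B(2) by (rule not_null_cell_region)
  have "AE x in lborel. l \<in> Y \<longrightarrow> x \<in> cell l \<longrightarrow> x \<in> B" for l
  proof (cases "l \<in> Y")
    case True
    obtain q where "(edge ^^ (s * q)) k l" using conn k(1) True by blast
    then show ?thesis using invariant_spread[OF rec[OF k(1)] B(1) inv per[OF k(1)] k(2)] by simp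
  qed simp
  then have "AE x in lborel. \<forall>l. l \<in> Y \<longrightarrow> x \<in> cell l \<longrightarrow> x \<in> B" by (simp add: AE_all_countable)
  with AE_good B(2)[unfolded ae_subset_def] show ?thesis
    unfolding ae_eq_def by eventually_elim (use good_region_iff good_cell in blast)
qed

lemma recurrent_class_conservative:
  assumes rec: "\<And>k. k \<in> Z \<Longrightarrow> recurrent k"
  shows "conservative (class_region a Z) T"
  unfolding conservative_def
proof
  assume "\<exists>W. wandering (class_region a Z) T W \<and> emeasure lborel W > 0"
  then obtain W where W: "W \<in> sets borel" "ae_subset W (class_region a Z)" "emeasure lborel W > 0"
    and dis: "\<And>i j. i \<noteq> j \<Longrightarrow> ae_disjoint ((T ^^ i) -` W \<inter> class_region a Z) ((T ^^ j) -` W \<inter> class_region a Z)"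
    by (auto simp: wandering_def)
  have "\<not> (AE x in lborel. x \<notin> W)" using W(1,3) by (simp flip: emeasure_lborel_eq_0_iff)
  then obtain k where k: "k \<in> Z" "\<not> (AE x in lborel. x \<notin> W \<inter> cell k)"
    using W(2) by (rule not_null_cell_region)
  have "AE x in lborel. x \<in> cell k \<longrightarrow> x \<notin> W"
  proof (rule recurrent_not_wandering[OF rec[OF k(1)] W(1)])
    fix n :: nat assume "n \<ge> 1"
    then have "ae_disjoint ((T ^^ n) -` W \<inter> class_region a Z) ((T ^^ 0) -` W \<inter> class_region a Z)"
      by (intro dis) auto
    then show "AE x in lborel. x \<in> cell k \<longrightarrow> x \<in> W \<longrightarrow> (T ^^ n) x \<notin> W"
      unfolding ae_disjoint_def
      by eventually_elim (use k(1) cell_subset_markov in \<open>auto simp: class_region_def\<close>)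
  qed
  then have "AE x in lborel. x \<notin> W \<inter> cell k" by eventually_elim auto
  then show False using k(2) by simp
qed

lemma recurrent_class_ergodic:
  assumes Z: "closed_class Z" and rec: "\<And>k. k \<in> Z \<Longrightarrow> recurrent k"
  shows "ergodic (class_region a Z) T"
  unfolding ergodic_def
proof (intro allI impI)
  fix A assume A: "invariant_set (class_region a Z) T A"
  have "ae_eq A (class_region a Z)" if "emeasure lborel A \<noteq> 0"
  proof (rule region_fill[where s=1, OF rec _ _ that])
    show "A \<in> sets borel" "ae_subset A (class_region a Z)" using A by (auto simp: invariant_set_def)
    have "AE x in lborel. x \<in> T -` A \<inter> class_region a Z \<longleftrightarrow> x \<in> A"
      using A by (simp add: invariant_set_def ae_eq_def)
    then show "AE x in lborel. x \<in> A \<longrightarrow> (T ^^ 1) x \<in> A" by eventually_elim auto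
    show "\<exists>q. (edge ^^ (1 * q)) k l" if "k \<in> Z" "l \<in> Z" for k l
      using Z that unfolding closed_class_def mult_1 by meson
  qed auto
  then show "emeasure lborel A = 0 \<or> ae_eq A (class_region a Z)" by blast
qed

lemma recurrent_class_splitting:
  assumes Z: "closed_class Z" and rec: "\<And>k. k \<in> Z \<Longrightarrow> recurrent k"
  shows "\<exists>P. cyclic_exact_splitting (class_region a Z) T (class_period a T Z) P"
proof -
  define d where "d = class_period a T Z"
  define M where "M = class_region a Z"
  obtain ph :: "int \<Rightarrow> nat" where
    ph: "\<And>i. ph i < d" "\<And>i j n. i \<in> Z \<Longrightarrow> (edge ^^ n) i j \<Longrightarrow> ph j = (ph i + n) mod d"
    "\<And>i j. i \<in> Z \<Longrightarrow> j \<in> Z \<Longrightarrow> ph i = ph j \<Longrightarrow> \<exists>n. (edge ^^ (d * n)) i j"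
    "\<And>r. r < d \<Longrightarrow> \<exists>j\<in>Z. ph j = r" "\<And>j. j \<in> Z \<Longrightarrow> \<exists>i\<in>Z. edge i j"
    using that by (rule phase_exists[OF Z, folded d_def])
  \<comment> \<open>States of equal phase are joined by paths whose length is a multiple of
    \<open>d\<close>, so \<open>Y i\<close> plays for \<open>T ^^ d\<close> the role that
    \<open>Z\<close> plays for \<open>T\<close>.\<close>
  define Y where "Y i = {j \<in> Z. ph j = i}" for i
  define P where "P i = class_region a (Y i)" for i
  have P_iff: "x \<in> P i \<longleftrightarrow> idx x \<in> Z \<and> ph (idx x) = i" if "good x" for x i
    using good_region_iff[OF that] by (simp add: P_def Y_def)
  have M_iff: "x \<in> M \<longleftrightarrow> idx x \<in> Z" if "good x" for x
    using good_region_iff[OF that] by (simp add: M_def)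
  have P_borel: "P i \<in> sets borel" for i by (simp add: P_def)
  have PM: "ae_subset (P i) M" for i
    unfolding ae_subset_def using AE_good by eventually_elim (simp add: P_iff M_iff)
  have step: "(T ^^ d) x \<in> P i \<longleftrightarrow> x \<in> P i" if "good x" "idx x \<in> Z" for x i
    using ph(2)[OF that(2) good_relpowp[OF that(1)], of d] ph(1) closed_class_orbit[OF Z that] that
    by (simp add: P_iff good_iterate)
  have invP: "invariant_set M (T ^^ d) (P i)" for i
    unfolding invariant_set_def ae_eq_def using P_borel PM AE_good
    by (auto elim!: eventually_mono simp: step P_iff M_iff)
  have fill: "ae_eq B (P i)"
    if B: "B \<in> sets borel" "ae_subset B (P i)" "emeasure lborel B \<noteq> 0" "AE x in lborel. x \<in> B \<longrightarrow> (T ^^ d) x \<in> B"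
    for B i
    unfolding P_def
  proof (rule region_fill[OF _ B(1) _ B(3,4)])
    show "ae_subset B (class_region a (Y i))" using B(2) by (simp add: P_def)
    show "d dvd n" if "k \<in> Y i" "(edge ^^ n) k k" for k n
      using class_period_facts(2)[OF Z _ that(2)] that(1) by (auto simp: d_def Y_def)
    show "\<exists>q. (edge ^^ (d * q)) k l" if "k \<in> Y i" "l \<in> Y i" for k l
      using ph(3) that by (auto simp: Y_def)
  qed (use rec in \<open>auto simp: Y_def\<close>)
  have comp: "ergodic_component M (T ^^ d) (P i)" if i: "i < d" for i
    unfolding ergodic_component_def
  proof (intro conjI allI impI)
    obtain j where "j \<in> Y i" using ph(4)[OF i] by (auto simp: Y_def)
    then show "0 < emeasure lborel (P i)"
      using region_not_null[of j "Y i"] P_borel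
      by (simp add: P_def emeasure_lborel_eq_0_iff zero_less_iff_neq_zero)
    fix B assume B: "invariant_set M (T ^^ d) B \<and> ae_subset B (P i)"
    then have "AE x in lborel. x \<in> (T ^^ d) -` B \<inter> M \<longleftrightarrow> x \<in> B" by (simp add: invariant_set_def ae_eq_def)
    then have "AE x in lborel. x \<in> B \<longrightarrow> (T ^^ d) x \<in> B" by eventually_elim auto
    then show "emeasure lborel B = 0 \<or> ae_eq B (P i)" using fill B by (auto simp: invariant_set_def)
  qed (rule invP)
  have ex: "exact (P i) (T ^^ d)" for i
    unfolding exact_def
  proof (intro allI impI)
    fix B assume B: "B \<in> sets borel \<and> ae_subset B (P i) \<and>
      (\<forall>n. \<exists>C. C \<in> sets borel \<and> C \<subseteq> P i \<and> ae_eq B (((T ^^ d) ^^ n) -` C \<inter> P i))"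
    then have "\<forall>n. \<exists>C. C \<in> sets borel \<and> ae_eq B ((T ^^ (d * n)) -` C \<inter> P i)"
      by (metis funpow_mult mult.commute)
    then obtain C where C: "\<And>n. C n \<in> sets borel" "\<And>n. ae_eq B ((T ^^ (d * n)) -` C n \<inter> P i)"
      by metis
    have "AE x in lborel. x \<in> P i \<longrightarrow> (T ^^ d) x \<in> P i"
      using AE_good by eventually_elim (simp add: step P_iff)
    \<comment> \<open>Once a tail set is known to be forward invariant, the filling argument used
      for ergodicity applies to it.\<close>
    then have "AE x in lborel. x \<in> B \<longrightarrow> (T ^^ d) x \<in> B"
      using tail_invariant[OF Z rec, of B "P i" C] B PM[of i] C unfolding d_def M_def by blast
    then show "emeasure lborel B = 0 \<or> ae_eq B (P i)" using fill B by blast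
  qed
  have disj: "ae_disjoint (P i) (P j)" if "i \<noteq> j" for i j
    unfolding ae_disjoint_def using AE_good by eventually_elim (use that in \<open>simp add: P_iff\<close>)
  have union: "ae_eq (\<Union>i<d. P i) M"
    unfolding ae_eq_def using AE_good by eventually_elim (use ph(1) in \<open>auto simp: P_iff M_iff\<close>)
  \<comment> \<open>Working at points \<open>y\<close> all of whose preimages are
    \<open>good\<close> gives the inclusion from left to right; the other one lifts \<open>y\<close>
    along an edge from the preceding phase.\<close>
  have img: "ae_eq (T ` P i) (P (Suc i mod d))" if i: "i < d" for i
    unfolding ae_eq_def using AE_T_image[OF AE_good] AE_good
  proof eventually_elim
    case (elim y)
    show ?case
    proof
      assume "y \<in> T ` P i"
      then obtain x where x: "x \<in> P i" "y = T x" by blast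
      then have g: "good x" using elim by blast
      have "(edge ^^ 1) (idx x) (idx y)" using good_relpowp[OF g, of 1] x by simp
      then show "y \<in> P (Suc i mod d)"
        using ph(2)[of "idx x" 1 "idx y"] closed_class_orbit[OF Z g, of 1] elim x P_iff[OF g] P_iff[of y] by simp
    next
      assume "y \<in> P (Suc i mod d)"
      then have y: "idx y \<in> Z" "ph (idx y) = Suc i mod d" using P_iff elim by auto
      then obtain j where j: "j \<in> Z" "edge j (idx y)" using ph(5) by blast
      then have e1: "(edge ^^ 1) j (idx y)" by (simp only: relpowp_1)
      have "Suc (ph j) mod d = Suc i mod d" using ph(2)[OF j(1) e1] y by simp
      then have "ph j = i" using ph(1)[of j] i by (auto simp: mod_Suc split: if_splits)
      moreover obtain x where x: "x \<in> cell j" "T x = y"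
        using relpowp_onto[OF e1, of y] good_cell[of y] elim by auto
      ultimately have "x \<in> P i" using j cell_subset_markov[of j] by (auto simp: P_def Y_def class_region_def)
      then show "y \<in> T ` P i" using x by blast
    qed
  qed
  show ?thesis
    unfolding cyclic_exact_splitting_def exact_component_def d_def[symmetric] M_def[symmetric]
    by (rule exI[of _ P]) (use comp ex disj union img in auto)
qed

section \<open>Limit sets of orbits in a basin\<close>

lemma omega_limit_subset:
  assumes Z: "closed_class Z" and x: "good x" "x \<in> class_basin a T Z"
  shows "omega_limit T x \<subseteq> class_region a Z"
proof
  fix y assume y: "y \<in> omega_limit T x"
  obtain N where N: "idx ((T ^^ N) x) \<in> Z" using x good_basin_iff by blast
  have inZ: "idx ((T ^^ n) x) \<in> Z" if "n \<ge> N" for n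
    using closed_class_orbit[OF Z good_iterate[OF x(1)] N, of "n - N"] that by (simp add: T_iterate_add)
  have visit: "\<exists>n\<ge>N. (T ^^ n) x \<in> U" if U: "open U" "y \<in> U" for U
  proof -
    obtain e where e: "e > 0" "ball y e \<subseteq> U" using U by (meson openE)
    then have "\<exists>\<^sub>F n in sequentially. dist ((T ^^ n) x) y < e" using y by (auto simp: omega_limit_def)
    then obtain n where "n \<ge> N" "dist ((T ^^ n) x) y < e" by (auto simp: frequently_sequentially)
    then show ?thesis using e by (auto simp: dist_commute intro!: exI[of _ n])
  qed
  show "y \<in> class_region a Z"
  proof (cases "y \<in> range a")
    case False
    then obtain j where j: "y \<in> cell j" by (rule cell_exists)
    obtain n where "n \<ge> N" "(T ^^ n) x \<in> cell j" using visit[OF cell_open j] by blast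
    then have "j \<in> Z" using inZ idx_eq by blast
    then show ?thesis using j cell_subset_markov by (auto simp: class_region_def)
  next
    case True
    then obtain j where j: "y = a j" by blast
    \<comment> \<open>Near the endpoint \<open>a j\<close> a late orbit point lies in one of the two
      adjacent cells, since it is itself no endpoint. Whichever of the two is visited belongs to
      \<open>Z\<close>, and both Markov intervals contain \<open>a j\<close>.\<close>
    have "y \<in> {a (j - 1)<..<a (j + 1)}" by (simp add: j)
    then obtain n where n: "n \<ge> N" "(T ^^ n) x \<in> {a (j - 1)<..<a (j + 1)}"
      using visit[of "{a (j - 1)<..<a (j + 1)}"] by auto
    have "(T ^^ n) x \<noteq> a j" using x(1) by (auto simp: good_def)
    then have "(T ^^ n) x \<in> cell (j - 1) \<or> (T ^^ n) x \<in> cell j" using n by (auto simp: cell_def)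
    then have "j - 1 \<in> Z \<or> j \<in> Z" using inZ[OF n(1)] by (auto dest: idx_eq)
    moreover have "y \<in> markov_interval a (j - 1)" "y \<in> markov_interval a j"
      by (auto simp: j markov_interval_def)
    ultimately show ?thesis by (auto simp: class_region_def)
  qed
qed

text \<open>The limit set is determined exactly, not only modulo null sets. The intersections of
  cells with rational intervals form a countable family, so almost every orbit in the class visits
  each nonempty member infinitely often; points of the basin inherit this from a later point of
  their orbit.\<close>

lemma omega_limit_eq:
  assumes Z: "closed_class Z" and rec: "\<And>k. k \<in> Z \<Longrightarrow> recurrent k"
  shows "AE x in lborel. x \<in> class_basin a T Z \<longrightarrow> omega_limit T x = class_region a Z"
proof -
  define Y where "Y j r s = cell j \<inter> {real_of_rat r<..<real_of_rat s}" for j r s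
  have "AE x in lborel. l \<in> Z \<longrightarrow> j \<in> Z \<longrightarrow> Y j r s \<noteq> {} \<longrightarrow> x \<in> cell l \<longrightarrow> (\<exists>\<^sub>\<infinity>n. (T ^^ n) x \<in> Y j r s)" for l j r s
  proof (cases "l \<in> Z \<and> j \<in> Z \<and> Y j r s \<noteq> {}")
    case True
    then obtain n where n: "n \<ge> 1" "(edge ^^ n) l j" using Z unfolding closed_class_def by blast
    have op: "open (Y j r s)" by (auto simp: Y_def)
    then have "\<not> negligible (Y j r s)" using True open_not_negligible by blast
    then have "\<not> (AE x in lborel. x \<notin> Y j r s)" by (simp add: AE_lborel_iff_negligible)
    then show ?thesis
      using recurrent_hits_cell[OF rec n(2,1), of "Y j r s"] True op by (auto simp: Y_def)
  qed auto
  then have "AE x in lborel. \<forall>l j r s. l \<in> Z \<longrightarrow> j \<in> Z \<longrightarrow> Y j r s \<noteq> {} \<longrightarrow> x \<in> cell l \<longrightarrow>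
      (\<exists>\<^sub>\<infinity>n. (T ^^ n) x \<in> Y j r s)"
    by (simp add: AE_all_countable)
  from AE_T_iterates[OF this] AE_good show ?thesis
  proof eventually_elim
    case (elim x)
    show ?case
    proof (intro impI equalityI omega_limit_subset[OF Z])
      assume x: "x \<in> class_basin a T Z"
      then obtain N where N: "idx ((T ^^ N) x) \<in> Z" using elim good_basin_iff by blast
      have cN: "(T ^^ N) x \<in> cell (idx ((T ^^ N) x))" using good_cell good_iterate elim by blast
      have hit: "\<exists>\<^sub>\<infinity>n. (T ^^ n) x \<in> Y j r s" if "j \<in> Z" "Y j r s \<noteq> {}" for j r s
        using elim(1) N cN that INFM_iterate by blast
      show "class_region a Z \<subseteq> omega_limit T x"
      proof
        fix y assume "y \<in> class_region a Z"
        then obtain j where j: "j \<in> Z" "y \<in> {a j..a (j + 1)}"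
          by (auto simp: class_region_def markov_interval_def)
        show "y \<in> omega_limit T x"
          unfolding omega_limit_def
        proof (intro CollectI allI impI)
          fix e :: real assume e: "e > 0"
          have "y \<in> closure (cell j)" using j(2) a_step(1)[of j] by (simp add: cell_def)
          then obtain z where z: "z \<in> cell j" "dist z y < e" using e by (meson closure_approachable)
          then have "y - e < z" "z < y + e" by (auto simp: dist_real_def)
          then obtain r s where r: "y - e < real_of_rat r" "real_of_rat r < z"
            and s: "z < real_of_rat s" "real_of_rat s < y + e"
            using of_rat_dense by metis
          have "Y j r s \<noteq> {}" using z r s by (auto simp: Y_def)
          then have "\<exists>\<^sub>F n in sequentially. (T ^^ n) x \<in> Y j r s"
            using hit j(1) by (simp add: cofinite_eq_sequentially)
          then show "\<exists>\<^sub>F n in sequentially. dist ((T ^^ n) x) y < e"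
            by (rule frequently_elim1) (use r s in \<open>auto simp: Y_def dist_real_def\<close>)
        qed
      qed
    qed (use elim in auto)
  qed
qed

lemma recurrent_class_regular:
  assumes Z: "closed_class Z" and rec: "\<And>k. k \<in> Z \<Longrightarrow> recurrent k"
  shows "regular_terminal_class a T Z"
proof -
  have "ae_subset (class_region a Z) (conservative_part T)"
    unfolding ae_subset_def conservative_part_def using AE_dissipative_iff
    by eventually_elim (use rec good_region_iff in auto)
  moreover have "ae_subset (class_basin a T Z - class_region a Z) (dissipative_part T)"
    unfolding ae_subset_def using AE_dissipative_iff
  proof eventually_elim
    case (elim x)
    show ?case
    proof
      assume "x \<in> class_basin a T Z - class_region a Z"
      then have x: "idx x \<notin> Z" "\<exists>n. idx ((T ^^ n) x) \<in> Z"
        using elim good_basin_iff good_region_iff by auto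
      then obtain n where n: "idx ((T ^^ n) x) \<in> Z" by blast
      \<comment> \<open>A recurrent state that feeds \<open>Z\<close> is fed back from
        \<open>Z\<close>, and would therefore belong to the closed class.\<close>
      have "\<not> recurrent (idx x)"
        using recurrent_feeds_back[OF _ good_relpowp, of x n] closed_class_relpowp[OF Z n] x(1) elim by blast
      then show "x \<in> dissipative_part T" using elim by blast
    qed
  qed
  ultimately show ?thesis
    unfolding regular_terminal_class_def Let_def
    using omega_limit_eq[OF assms] recurrent_class_conservative[OF rec] recurrent_class_ergodic[OF assms]
      recurrent_class_splitting[OF assms] by blast
qed

subsection \<open>Invariant hulls and basins\<close>

lemma invariant_hull_iff: "x \<in> invariant_hull T A \<longleftrightarrow> (\<exists>k\<ge>1. \<exists>n. \<exists>y\<in>A. (T ^^ n) y = (T ^^ k) x)"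
  by (auto simp: invariant_hull_def image_iff eq_commute)

lemma invariant_hullI: "y \<in> A \<Longrightarrow> (T ^^ n) y = (T ^^ k) x \<Longrightarrow> k \<ge> 1 \<Longrightarrow> x \<in> invariant_hull T A"
  unfolding invariant_hull_iff by blast

lemma AE_invariant_iterates:
  assumes "invariant_set UNIV T B"
  shows "AE x in lborel. \<forall>n. (T ^^ n) x \<in> B \<longleftrightarrow> x \<in> B"
proof -
  have "AE x in lborel. T x \<in> B \<longleftrightarrow> x \<in> B" using assms by (simp add: invariant_set_def ae_eq_def)
  from AE_T_iterates[OF this] show ?thesis
  proof eventually_elim
    case (elim x)
    have "(T ^^ n) x \<in> B \<longleftrightarrow> x \<in> B" for n
      by (induction n) (use elim in auto)
    then show ?case by blast
  qed
qed

lemma basin_invariant: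
  assumes Z: "closed_class Z"
  shows "invariant_set UNIV T (class_basin a T Z)"
proof -
  have "AE x in lborel. T x \<in> class_basin a T Z \<longleftrightarrow> x \<in> class_basin a T Z"
    using AE_good
  proof eventually_elim
    case (elim x)
    have "idx ((T ^^ n) (T x)) = idx ((T ^^ Suc n) x)" for n by (simp add: funpow_swap1)
    moreover have "idx ((T ^^ Suc n) x) \<in> Z" if "idx ((T ^^ n) x) \<in> Z" for n
      using closed_class_orbit[OF Z good_iterate[OF elim] that, of 1] by simp
    ultimately show ?case using good_basin_iff[OF elim] good_basin_iff[OF good_T[OF elim]] by metis
  qed
  then show ?thesis by (simp add: invariant_set_def ae_subset_def ae_eq_def)
qed

lemma region_subset_imp_basin_subset:
  assumes B: "invariant_set UNIV T B" and sub: "\<And>l. l \<in> Z \<Longrightarrow> AE x in lborel. x \<in> cell l \<longrightarrow> x \<in> B"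
  shows "ae_subset (class_basin a T Z) B"
proof -
  have "AE x in lborel. \<forall>l. l \<in> Z \<longrightarrow> x \<in> cell l \<longrightarrow> x \<in> B" using sub by (simp add: AE_all_countable)
  from AE_T_iterates[OF this] AE_invariant_iterates[OF B] AE_good show ?thesis
    unfolding ae_subset_def by eventually_elim (metis good_basin_iff good_cell good_iterate)
qed

lemma basin_not_null: "k \<in> Z \<Longrightarrow> \<not> (AE x in lborel. x \<notin> class_basin a T Z)"
proof
  assume k: "k \<in> Z" and "AE x in lborel. x \<notin> class_basin a T Z"
  from this(2) AE_good have "AE x in lborel. x \<notin> class_region a Z"
    by eventually_elim (metis funpow_0 good_basin_iff good_region_iff)
  then show False using region_not_null[OF k] by simp
qed

text \<open>An invariant subset of the basin is determined by its trace on the region, because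
  orbits in the basin enter the region and membership is constant along orbits. The trace is null or
  full by the filling argument.\<close>

lemma basin_ergodic_component:
  assumes Z: "closed_class Z" and rec: "\<And>k. k \<in> Z \<Longrightarrow> recurrent k"
  shows "ergodic_component UNIV T (class_basin a T Z)"
  unfolding ergodic_component_def
proof (intro conjI allI impI basin_invariant[OF Z])
  obtain k where "k \<in> Z" using Z by (auto simp: closed_class_def)
  then show "0 < emeasure lborel (class_basin a T Z)"
    using basin_not_null by (simp add: emeasure_lborel_eq_0_iff zero_less_iff_neq_zero)
  fix B assume B: "invariant_set UNIV T B \<and> ae_subset B (class_basin a T Z)"
  then have Bb [measurable]: "B \<in> sets borel" by (simp add: invariant_set_def)
  note iter = AE_invariant_iterates[OF conjunct1[OF B]]
  have "ae_eq B (class_basin a T Z)" if pos: "emeasure lborel B \<noteq> 0"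
  proof -
    define B' where "B' = B \<inter> class_region a Z"
    have "ae_eq B' (class_region a Z)"
    proof (rule region_fill[where s=1, OF rec])
      show "emeasure lborel B' \<noteq> 0"
      proof
        assume "emeasure lborel B' = 0"
        then have "AE x in lborel. x \<notin> B'" by (simp add: emeasure_lborel_eq_0_iff B'_def)
        from AE_T_iterates[OF this] iter AE_good conjunct2[OF B, unfolded ae_subset_def]
        have "AE x in lborel. x \<notin> B"
          by eventually_elim (metis B'_def IntI good_basin_iff good_iterate good_region_iff)
        then show False using pos by (simp add: emeasure_lborel_eq_0_iff)
      qed
      show "AE x in lborel. x \<in> B' \<longrightarrow> (T ^^ 1) x \<in> B'"
        using iter AE_good
      proof eventually_elim
        case (elim x)
        then show ?case
          using closed_class_orbit[OF Z, of x 1] good_region_iff[of x] good_region_iff[OF good_T, of x]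
            spec[OF elim(1), of 1] by (auto simp: B'_def)
      qed
      show "\<exists>q. (edge ^^ (1 * q)) k l" if "k \<in> Z" "l \<in> Z" for k l
        using Z that unfolding closed_class_def mult_1 by meson
    qed (auto simp: B'_def ae_subset_def)
    then have "AE x in lborel. x \<in> class_region a Z \<longrightarrow> x \<in> B"
      unfolding ae_eq_def by eventually_elim (auto simp: B'_def)
    then have "AE x in lborel. x \<in> cell l \<longrightarrow> x \<in> B" if "l \<in> Z" for l
      by eventually_elim (use that cell_subset_markov in \<open>auto simp: class_region_def\<close>)
    then have "ae_subset (class_basin a T Z) B"
      by (rule region_subset_imp_basin_subset[OF conjunct1[OF B]])
    with conjunct2[OF B] show ?thesis
      unfolding ae_subset_def ae_eq_def by eventually_elim blast
  qed
  then show "emeasure lborel B = 0 \<or> ae_eq B (class_basin a T Z)" by blast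
qed

text \<open>The outside state \<open>j\<close> cannot be recurrent, for \<open>Z\<close> does not
  feed it. So the dissipative \<open>cell j\<close> has images covering every cell of
  \<open>Z\<close>, which puts the basin into the hull of the dissipative part as well.\<close>

lemma recurrent_basin_subset_hull_CD:
  assumes Z: "closed_class Z" and rec: "\<And>k. k \<in> Z \<Longrightarrow> recurrent k"
    and out: "j \<notin> Z" "i \<in> Z" "feeds a T j i"
  shows "ae_subset (class_basin a T Z) (hull_CD T)"
proof -
  have trans: "\<not> recurrent j"
    using recurrent_feeds_back[of j _ i] out closed_class_relpowp[OF Z out(2)] unfolding feeds_iff by blast
  have "AE y in lborel. l \<in> Z \<longrightarrow> y \<in> cell l \<longrightarrow> (\<exists>n. \<exists>z\<in>dissipative_part T. (T ^^ n) z = y)" for l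
  proof (cases "l \<in> Z")
    case True
    obtain m where "(edge ^^ m) i l" using Z True out unfolding closed_class_def by blast
    then obtain n where n: "(edge ^^ n) j l" using out(3) unfolding feeds_iff by (meson relpowp_trans)
    from AE_T_iterate_image[OF AE_dissipative_iff, of n] show ?thesis
    proof eventually_elim
      case (elim y)
      show ?case
      proof (intro impI)
        assume "y \<in> cell l"
        then obtain z where z: "z \<in> cell j" "(T ^^ n) z = y" using relpowp_onto[OF n] by blast
        then have "z \<in> dissipative_part T" using elim trans by (simp add: idx_eq)
        then show "\<exists>n. \<exists>z\<in>dissipative_part T. (T ^^ n) z = y" using z by blast
      qed
    qed
  qed simp
  then have "AE y in lborel. \<forall>l. l \<in> Z \<longrightarrow> y \<in> cell l \<longrightarrow> (\<exists>n. \<exists>z\<in>dissipative_part T. (T ^^ n) z = y)"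
    by (simp add: AE_all_countable)
  from AE_T_iterates[OF this] AE_T_iterates[OF AE_dissipative_iff] AE_good show ?thesis
    unfolding ae_subset_def
  proof eventually_elim
    case (elim x)
    show ?case
    proof
      assume "x \<in> class_basin a T Z"
      then obtain r where "idx ((T ^^ r) x) \<in> Z" using elim good_basin_iff by blast
      \<comment> \<open>One more step is taken because the hull uses preimages under
        \<open>T ^^ k\<close> with \<open>k \<ge> 1\<close> only.\<close>
      then have r: "idx ((T ^^ Suc r) x) \<in> Z"
        using closed_class_orbit[OF Z good_iterate[OF elim(3)], of r 1] by simp
      have "(T ^^ Suc r) x \<in> conservative_part T"
        using elim(2) r rec by (auto simp: conservative_part_def simp del: funpow.simps)
      then have "x \<in> invariant_hull T (conservative_part T)"
        by (rule invariant_hullI[where n = 0 and k = "Suc r"]) simp_all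
      moreover have "\<exists>n. \<exists>z\<in>dissipative_part T. (T ^^ n) z = (T ^^ Suc r) x"
        using elim(1) r good_cell[OF good_iterate[OF elim(3)]] by blast
      then have "x \<in> invariant_hull T (dissipative_part T)"
        using invariant_hullI[where k = "Suc r"] by force
      ultimately show "x \<in> hull_CD T" by (simp add: hull_CD_def)
    qed
  qed
qed

text \<open>Hulls contain forward images, so almost every \<open>x\<close> is taken such that all
  points sharing a later orbit point with it are typical. A conservative one among them starts in a
  recurrent state, and recurrence travels along its orbit.\<close>

lemma AE_conservative_hull:
  "AE x in lborel. x \<in> invariant_hull T (conservative_part T) \<longrightarrow> (\<exists>k. recurrent (idx ((T ^^ k) x)))"
proof -
  have "AE x in lborel. \<forall>n y. (T ^^ n) y = x \<longrightarrow> good y \<and> (y \<in> dissipative_part T \<longleftrightarrow> \<not> recurrent (idx y))"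
    unfolding AE_all_countable using AE_T_iterate_image[OF AE_dissipative_iff] by blast
  from AE_T_iterates[OF this] show ?thesis
  proof eventually_elim
    case (elim x)
    show ?case
    proof
      assume "x \<in> invariant_hull T (conservative_part T)"
      then obtain k n y where y: "y \<in> conservative_part T" "(T ^^ n) y = (T ^^ k) x"
        unfolding invariant_hull_iff by blast
      then have "good y" "recurrent (idx y)" using elim by (auto simp: conservative_part_def)
      then have "recurrent (idx ((T ^^ k) x))"
        using recurrent_feeds[OF _ good_relpowp, of y n] y(2) by simp
      then show "\<exists>k. recurrent (idx ((T ^^ k) x))" by blast
    qed
  qed
qed

text \<open>An orbit meeting a recurrent state would carry recurrence into \<open>Z\<close>. Hence
  no state on the orbit is recurrent, which keeps it out of the hull of the conservative
  part.\<close>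

lemma transient_basin_subset_hull_D:
  assumes Z: "closed_class Z" and trans: "\<And>k. k \<in> Z \<Longrightarrow> \<not> recurrent k"
  shows "ae_subset (class_basin a T Z) (hull_D T)"
  unfolding ae_subset_def using AE_dissipative_iff AE_conservative_hull
proof eventually_elim
  case (elim x)
  show ?case
  proof
    assume "x \<in> class_basin a T Z"
    then obtain m where m: "idx ((T ^^ m) x) \<in> Z" using elim good_basin_iff by blast
    have nrec: "\<not> recurrent (idx ((T ^^ k) x))" for k
    proof
      assume "recurrent (idx ((T ^^ k) x))"
      then have "recurrent (idx ((T ^^ m) ((T ^^ k) x)))"
        using recurrent_feeds good_relpowp[OF good_iterate] elim by blast
      moreover have "idx ((T ^^ k) ((T ^^ m) x)) \<in> Z"
        using closed_class_orbit[OF Z good_iterate m] elim by blast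
      ultimately show False using trans by (simp add: T_iterate_add add.commute)
    qed
    then have "x \<in> dissipative_part T" using nrec[of 0] elim by simp
    then have "x \<in> invariant_hull T (dissipative_part T)"
      by (rule invariant_hullI[where n = 1 and k = 1]) simp_all
    then show "x \<in> hull_D T" using elim nrec by (auto simp: hull_D_def hull_CD_def)
  qed
qed

text \<open>Pigeonhole: an orbit confined to finitely many cells visits one of them infinitely
  often.\<close>

lemma finite_closed_class_recurrent:
  assumes Z: "closed_class Z" and fin: "finite Z"
  shows "\<exists>k\<in>Z. recurrent k"
proof (rule ccontr)
  assume none: "\<not> ?thesis"
  have "AE x in lborel. k \<in> Z \<longrightarrow> \<not> (x \<in> cell k \<and> (\<exists>\<^sub>\<infinity>n. (T ^^ n) x \<in> cell k))" for k
    using none unfolding recurrent_def by (cases "k \<in> Z") auto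
  then have "AE x in lborel. \<forall>k. k \<in> Z \<longrightarrow> \<not> (x \<in> cell k \<and> (\<exists>\<^sub>\<infinity>n. (T ^^ n) x \<in> cell k))"
    unfolding AE_all_countable by blast
  from AE_T_iterates[OF this] AE_good
  have "AE x in lborel. x \<notin> class_region a Z"
  proof eventually_elim
    case (elim x)
    show ?case
    proof
      assume "x \<in> class_region a Z"
      then have "idx ((T ^^ n) x) \<in> Z" for n
        using closed_class_orbit[OF Z elim(2)] good_region_iff[OF elim(2)] by blast
      then have "\<exists>\<^sub>\<infinity>n. \<exists>l\<in>Z. (T ^^ n) x \<in> cell l"
        using good_cell[OF good_iterate[OF elim(2)]] by (auto simp: INFM_nat)
      then obtain l where l: "l \<in> Z" "\<exists>\<^sub>\<infinity>n. (T ^^ n) x \<in> cell l"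
        using fin by (auto simp: INFM_finite_Bex_distrib)
      then obtain n where "(T ^^ n) x \<in> cell l" by (auto simp: INFM_nat)
      then show False using elim(1) l INFM_iterate by blast
    qed
  qed
  moreover obtain k where "k \<in> Z" using Z by (auto simp: closed_class_def)
  ultimately show False using region_not_null by blast
qed

text \<open>Lying in the hull of the conservative part forces \<open>A\<close> to meet some
  recurrent cell in positive measure. The class of that cell is closed, \<open>A\<close> contains
  its basin by spreading, and minimality of the component gives equality.\<close>

lemma ergodic_component_eq_basin:
  assumes A: "ergodic_component UNIV T A" and hull: "ae_subset A (hull_CD T)"
  shows "\<exists>Z\<in>terminal_classes a T. ae_eq A (class_basin a T Z)"
proof -
  have inv: "invariant_set UNIV T A" and Ab: "A \<in> sets borel" and pos: "\<not> (AE x in lborel. x \<notin> A)"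
    using A by (auto simp: ergodic_component_def invariant_set_def simp flip: emeasure_lborel_eq_0_iff)
  note iter = AE_invariant_iterates[OF inv]
  have "\<exists>k. recurrent k \<and> \<not> (AE x in lborel. x \<notin> A \<inter> cell k)"
  proof (rule ccontr)
    assume none: "\<not> ?thesis"
    have "AE x in lborel. \<forall>k. recurrent k \<longrightarrow> x \<notin> A \<inter> cell k"
      unfolding AE_all_countable
    proof
      show "AE x in lborel. recurrent k \<longrightarrow> x \<notin> A \<inter> cell k" for k
        using none by (cases "recurrent k") auto
    qed
    from AE_T_iterates[OF this] iter AE_conservative_hull AE_good hull[unfolded ae_subset_def]
    have "AE x in lborel. x \<notin> A"
      by eventually_elim (metis IntD1 IntI good_cell good_iterate hull_CD_def)
    then show False using pos by simp
  qed
  then obtain k where k: "recurrent k" "\<not> (AE x in lborel. x \<notin> A \<inter> cell k)" by blast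
  define Z where "Z = {(j, k). communicate a T j k} `` {k}"
  have kZ: "k \<in> Z" by (simp add: Z_def communicate_def)
  have Zc: "Z \<in> comm_classes a T" unfolding comm_classes_def Z_def by (rule quotientI) simp
  have fed: "\<exists>n. (edge ^^ n) k l" if "l \<in> Z" for l
    using that unfolding Z_def communicate_def feeds_iff by (auto intro: exI[of _ "0::nat"])
  have rec: "recurrent l" if "l \<in> Z" for l using fed[OF that] recurrent_feeds[OF k(1)] by blast
  have ess: "\<forall>l\<in>Z. \<not> inessential a T l"
    unfolding inessential_def feeds_iff using rec recurrent_feeds_back by blast
  have Z: "closed_class Z" using essential_closed_class[OF Zc ess] .
  have fwd: "AE x in lborel. x \<in> A \<longrightarrow> (T ^^ 1) x \<in> A" using iter by eventually_elim blast
  have cells: "AE x in lborel. x \<in> cell l \<longrightarrow> x \<in> A" if l: "l \<in> Z" for l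
  proof -
    obtain q where "(edge ^^ (1 * q)) k l" using fed[OF l] by auto
    from invariant_spread[OF k(1) Ab fwd _ k(2) this] show ?thesis by simp
  qed
  have EA: "ae_subset (class_basin a T Z) A" using region_subset_imp_basin_subset[OF inv cells] .
  have "emeasure lborel (class_basin a T Z) \<noteq> 0"
    using basin_not_null[OF kZ] by (simp add: emeasure_lborel_eq_0_iff)
  then have "ae_eq (class_basin a T Z) A"
    using A EA basin_invariant[OF Z] unfolding ergodic_component_def by blast
  then have "ae_eq A (class_basin a T Z)" unfolding ae_eq_def by eventually_elim blast
  \<comment> \<open>Here the hull of the dissipative part is used: a dissipative point whose orbit
    merges with one in \<open>Z\<close> starts in a transient state outside \<open>Z\<close>, and
    this state feeds \<open>Z\<close>.\<close>
  moreover have "\<exists>j. j \<notin> Z \<and> (\<exists>l\<in>Z. feeds a T j l)"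
  proof (rule ccontr)
    assume none: "\<not> ?thesis"
    have "AE x in lborel. \<forall>n y. (T ^^ n) y = x \<longrightarrow> good y \<and> (y \<in> dissipative_part T \<longleftrightarrow> \<not> recurrent (idx y))"
      unfolding AE_all_countable using AE_T_iterate_image[OF AE_dissipative_iff] by blast
    from AE_T_iterates[OF this] cells[OF kZ] hull[unfolded ae_subset_def] AE_good
    have "AE x in lborel. x \<notin> cell k"
    proof eventually_elim
      case (elim x)
      show ?case
      proof
        assume x: "x \<in> cell k"
        then have "x \<in> invariant_hull T (dissipative_part T)" using elim by (auto simp: hull_CD_def)
        then obtain m n y where y: "y \<in> dissipative_part T" "(T ^^ n) y = (T ^^ m) x"
          unfolding invariant_hull_iff by blast
        then have g: "good y" "\<not> recurrent (idx y)" using elim by auto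
        have "idx ((T ^^ n) y) \<in> Z"
          using closed_class_orbit[OF Z elim(4), of m] x kZ y(2) by (simp add: idx_eq)
        moreover have "(edge ^^ n) (idx y) (idx ((T ^^ n) y))" using good_relpowp[OF g(1)] .
        ultimately have "idx y \<in> Z" using none unfolding feeds_iff by (cases "n = 0") auto
        then show False using rec g(2) by blast
      qed
    qed
    then show False using cell_not_null by simp
  qed
  then have "Z \<in> terminal_classes a T" using Zc ess by (auto simp: terminal_classes_def)
  ultimately show ?thesis by blast
qed

section \<open>Recurrent and transient terminal classes\<close>

lemma terminal_class_dichotomy:
  assumes Z: "Z \<in> terminal_classes a T"
  shows "(ergodic_component UNIV T (class_basin a T Z) \<and> ae_subset (class_basin a T Z) (hull_CD T) \<and>
      regular_terminal_class a T Z) \<or>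
    infinite Z \<and> invariant_set UNIV T (class_basin a T Z) \<and> ae_subset (class_basin a T Z) (hull_D T)"
proof (cases "\<exists>k\<in>Z. recurrent k")
  case True
  note cl = terminal_closed_class[OF Z]
  have rec: "recurrent k" if "k \<in> Z" for k using True closed_class_recurrent[OF cl] that by blast
  obtain i j where "j \<notin> Z" "i \<in> Z" "feeds a T j i" using Z by (auto simp: terminal_classes_def)
  then show ?thesis
    using basin_ergodic_component[OF cl rec] recurrent_basin_subset_hull_CD[OF cl rec]
      recurrent_class_regular[OF cl rec] by blast
next
  case False
  note cl = terminal_closed_class[OF Z]
  show ?thesis
    using False basin_invariant[OF cl] transient_basin_subset_hull_D[OF cl] finite_closed_class_recurrent[OF cl]
    by blast
qed

text \<open>The two hulls are disjoint by definition, so a basin of positive measure inside one of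
  them leaves only the first alternative of the dichotomy.\<close>

lemma terminal_class_regular:
  assumes Z: "Z \<in> terminal_classes a T" and E: "ergodic_component UNIV T (class_basin a T Z)"
    and hull: "ae_subset (class_basin a T Z) (hull_CD T)"
  shows "regular_terminal_class a T Z"
proof -
  have "\<not> ae_subset (class_basin a T Z) (hull_D T)"
  proof
    assume "ae_subset (class_basin a T Z) (hull_D T)"
    with hull have "AE x in lborel. x \<notin> class_basin a T Z"
      unfolding ae_subset_def by eventually_elim (auto simp: hull_D_def)
    then show False using E by (simp add: ergodic_component_def flip: emeasure_lborel_eq_0_iff)
  qed
  then show ?thesis using terminal_class_dichotomy[OF Z] by blast
qed

end

theorem proposition2p6:
  fixes a :: "int \<Rightarrow> real" and T :: "real \<Rightarrow> real"
    and \<tau> \<tau>' \<tau>'' :: "int \<Rightarrow> real \<Rightarrow> real"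
  assumes "expanding_markov_map a T \<tau> \<tau>' \<tau>''"
  shows
    "(\<forall>A. ergodic_component UNIV T A \<and> ae_subset A (hull_CD T) \<longrightarrow>
          (\<exists>Z\<in>terminal_classes a T. ae_eq A (class_basin a T Z))) \<and>
     (\<forall>Z\<in>terminal_classes a T.
          ergodic_component UNIV T (class_basin a T Z) \<and> ae_subset (class_basin a T Z) (hull_CD T)
            \<longrightarrow> regular_terminal_class a T Z) \<and>
     (\<forall>Z\<in>terminal_classes a T. finite Z \<longrightarrow>
          ergodic_component UNIV T (class_basin a T Z) \<and> ae_subset (class_basin a T Z) (hull_CD T) \<and>
          regular_terminal_class a T Z) \<and>
     (\<forall>Z\<in>terminal_classes a T. infinite Z \<longrightarrow>
          (ergodic_component UNIV T (class_basin a T Z) \<and> ae_subset (class_basin a T Z) (hull_CD T) \<and>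
             regular_terminal_class a T Z) \<or>
          (invariant_set UNIV T (class_basin a T Z) \<and> ae_subset (class_basin a T Z) (hull_D T)))"
proof -
  interpret expanding_markov_map a T \<tau> \<tau>' \<tau>'' by (rule assms)
  obtain \<theta> where "\<theta> > 0" "\<forall>j. 0 < a (j + 1) - a j \<and> a (j + 1) - a j \<le> \<theta>" using A1 by blast
  moreover obtain \<kappa> where "\<kappa> > 1" "\<forall>j. \<forall>x\<in>markov_interval a j. \<bar>\<tau>' j x\<bar> \<ge> \<kappa>" using A3 by blast
  moreover obtain \<eta> where "\<eta> > 0" "\<forall>j. \<forall>x\<in>markov_interval a j. \<bar>\<tau>'' j x / (\<tau>' j x)\<^sup>2\<bar> \<le> \<eta>"
    using A4 by blast
  ultimately interpret markov_map_constants a T \<tau> \<tau>' \<tau>'' \<theta> \<kappa> \<eta>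
    by unfold_locales auto
  show ?thesis
    using ergodic_component_eq_basin terminal_class_regular terminal_class_dichotomy by blast
qed

end
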